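(* Let $P\subset(\mathbb{R}^n)^*$ be a labeled polytope with $d$ facets, written as $P=\bigcap_{r=1}^d\{x\in(\mathbb{R}^n)^*:\ell_r(x)\ge 0\}$ with $\ell_r(x)=\langle x,m_r\mu_r\rangle-\lambda_r$, where $\mu_r\in\mathbb{Z}^n$ is the primitive inward normal of the $r$-th facet, $m_r\in\mathbb{N}$ its label and $\lambda_r\in\mathbb{R}$. Let $(M_P,\omega_P,\tau_P)$ be the associated symplectic toric orbifold with moment map $\phi_P:M_P\to P$, and let $J_P$ be its canonical compatible toric complex structure. Then, in suitable symplectic $(x,\theta)$-coordinates on $\breve M_P=\phi_P^{-1}(\breve P)\cong\breve P\times\mathbb{T}^n$, the complex structure $J_P$ is represented by the matrix $$\begin{bmatrix}0&-G^{-1}\\ G&0\end{bmatrix},\qquad G=\mathrm{Hess}_x(g_P),$$ where the potential $g_P\in C^\infty(\breve P)$ is $$g_P(x)=\frac12\sum_{r=1}^d\ell_r(x)\log\ell_r(x).$$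
   Context: $\mathbb{T}^n=\mathbb{R}^n/2\pi\mathbb{Z}^n$. A labeled polytope is a compact convex polytope $P\subset(\mathbb{R}^n)^*$ with nonempty interior $\breve P$ that is simple and rational ($n$ edges meet at each vertex $p$, each edge at $p$ has the form $p+tv_i$, $t\geq 0$, with $v_i\in(\mathbb{Z}^n)^*$, and the $v_1,\dots,v_n$ at $p$ can be chosen to be a $\mathbb{Q}$-basis of the lattice), together with a positive integer label $m_r$ attached to each facet. Construction of $(M_P,\omega_P,\tau_P,J_P)$: let $\beta:\mathbb{R}^d\to\mathbb{R}^n$ be linear with $\beta(e_r)=m_r\mu_r$ (it is surjective), let $K$ be the kernel of the induced homomorphism $\mathbb{T}^d\to\mathbb{T}^n$, with Lie algebra $\mathfrak{k}=\ker\beta$ and inclusion $\iota:\mathfrak{k}\to\mathbb{R}^d$. Let $\mathbb{T}^d$ act on $\mathbb{C}^d$ (coordinates $z_r=u_r+iv_r$, symplectic form $\sum_r du_r\wedge dv_r$) in the standard way, with moment map $\phi_{\mathbb{T}^d}(z)=\sum_r(|z_r|^2/2+\lambda_r)e_r^*$; $K$ acts with moment map $\phi_K=\iota^*\circ\phi_{\mathbb{T}^d}$. Set $Z=\phi_K^{-1}(0)$ and $M_P=Z/K$, a compact orbifold of dimension $2n$, with $\omega_P$ the reduced symplectic form, $\tau_P$ the induced action of $\mathbb{T}^n\cong\mathbb{T}^d/K$, and $J_P$ the complex structure induced by the standard one of $\mathbb{C}^d$ by Kähler reduction. The moment map $\phi_P:M_P\to(\mathbb{R}^n)^*$ is normalized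 by $\beta^*\circ\phi_P\circ\pi=\phi_{\mathbb{T}^d}|_Z$, with $\pi:Z\to M_P$ the quotient map, and its image is $P$. Sign convention for moment maps: $\iota(\xi_M)\omega=-d\langle\xi,\phi\rangle$. The set $\breve M_P=\phi_P^{-1}(\breve P)$ is open and dense and consists of the points where the torus action is free. Symplectic (action-angle) coordinates $(x,\theta)$ on $\breve M_P$ are an identification $\breve M_P\cong\breve P\times\mathbb{T}^n$ with $x=\phi_P$, with $\mathbb{T}^n$ acting by translations of $\theta$, and with $\omega_P=\sum_j dx_j\wedge d\theta_j$. A complex structure $J$ is compatible with $\omega_P$ if $\omega_P(\cdot,J\cdot)$ is symmetric and positive definite; it is toric if it is $\mathbb{T}^n$-invariant. $J$ is represented by a matrix with respect to the frame $(\partial_{x_1},\dots,\partial_{x_n},\partial_{\theta_1},\dots,\partial_{\theta_n})$. *)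

theory Defs
  imports "HOL-Analysis.Analysis"
begin

section \<open>Smooth functions and Hessians\<close>

primrec C_k_on :: "nat \<Rightarrow> 'a::real_normed_vector set \<Rightarrow> ('a \<Rightarrow> 'b::real_normed_vector) \<Rightarrow> bool" where
  "C_k_on 0 U f \<longleftrightarrow> continuous_on U f"
| "C_k_on (Suc k) U f \<longleftrightarrow> (\<forall>x\<in>U. f differentiable (at x)) \<and>
     (\<forall>v. C_k_on k U (\<lambda>x. frechet_derivative f (at x) v))"

text \<open>Only used for open \<open>U\<close>.\<close>

definition smooth_on :: "'a::real_normed_vector set \<Rightarrow> ('a \<Rightarrow> 'b::real_normed_vector) \<Rightarrow> bool" where
  "smooth_on U f \<longleftrightarrow> (\<forall>k. C_k_on k U f)"

definition partial :: "'n \<Rightarrow> (real^'n::finite \<Rightarrow> real) \<Rightarrow> real^'n \<Rightarrow> real" where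
  "partial i f x = frechet_derivative f (at x) (axis i 1)"

definition Hess :: "(real^'n::finite \<Rightarrow> real) \<Rightarrow> real^'n \<Rightarrow> real^'n^'n" where
  "Hess f x = (\<chi> i j. partial i (partial j f) x)"

section \<open>The torus \<open>\<real>\<^sup>n / 2\<pi>\<int>\<^sup>n\<close>\<close>

definition period_lattice :: "(real^'n::finite) set" where
  "period_lattice = {t. \<forall>i. \<exists>k::int. t $ i = 2 * pi * of_int k}"

lemma period_lattice_0: "0 \<in> period_lattice"
  unfolding period_lattice_def by (auto intro: exI[of _ 0])

lemma period_lattice_add: "s + t \<in> period_lattice" if st: "s \<in> period_lattice" "t \<in> period_lattice"
  unfolding period_lattice_def
proof (clarsimp)
  fix i
  obtain k l :: int where "s $ i = 2 * pi * of_int k" "t $ i = 2 * pi * of_int l"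
    using st unfolding period_lattice_def mem_Collect_eq by metis
  then have "s $ i + t $ i = 2 * pi * of_int (k + l)" by (simp add: algebra_simps)
  then show "\<exists>k::int. s $ i + t $ i = 2 * pi * k" ..
qed

lemma period_lattice_uminus: "- t \<in> period_lattice" if t: "t \<in> period_lattice"
  unfolding period_lattice_def
proof (clarsimp)
  fix i
  obtain k :: int where "t $ i = 2 * pi * of_int k"
    using t unfolding period_lattice_def mem_Collect_eq by metis
  then have "- t $ i = 2 * pi * of_int (- k)" by simp
  then show "\<exists>k::int. - t $ i = 2 * pi * k" ..
qed

quotient_type (overloaded) 'n torus = "real^'n::finite" / "\<lambda>s t. s - t \<in> period_lattice"
  morphisms torus_rep torus_class
proof (rule equivpI)
  show "reflp (\<lambda>s t::real^'n. s - t \<in> period_lattice)"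
    by (simp add: reflp_def period_lattice_0)
  show "symp (\<lambda>s t::real^'n. s - t \<in> period_lattice)"
    by (rule sympI) (metis period_lattice_uminus minus_diff_eq)
  show "transp (\<lambda>s t::real^'n. s - t \<in> period_lattice)"
    by (rule transpI) (metis period_lattice_add diff_add_cancel add_diff_eq)
qed

instantiation torus :: (finite) ab_group_add
begin

lift_definition zero_torus :: "'a torus" is 0 .

lift_definition plus_torus :: "'a torus \<Rightarrow> 'a torus \<Rightarrow> 'a torus" is "(+)"
  by (metis period_lattice_add add_diff_add)

lift_definition uminus_torus :: "'a torus \<Rightarrow> 'a torus" is uminus
  by (metis period_lattice_uminus minus_diff_minus)

lift_definition minus_torus :: "'a torus \<Rightarrow> 'a torus \<Rightarrow> 'a torus" is "(-)"
proof -
  fix a b c d :: "real^'a"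
  assume "a - b \<in> period_lattice" "c - d \<in> period_lattice"
  then have "(a - b) + - (c - d) \<in> period_lattice"
    using period_lattice_add period_lattice_uminus by blast
  then show "a - c - (b - d) \<in> period_lattice" by (simp add: algebra_simps)
qed

instance
  by standard (transfer, simp add: period_lattice_0 algebra_simps)+

end

instantiation torus :: (finite) topological_space
begin

definition open_torus :: "'a torus set \<Rightarrow> bool" where
  "open_torus U \<longleftrightarrow> open (torus_class -` U)"

instance
proof
  show "open (UNIV :: 'a torus set)" by (simp add: open_torus_def)
  show "open (S \<inter> T)" if "open S" "open T" for S T :: "'a torus set"
    using that by (simp add: open_torus_def vimage_Int open_Int)
  show "open (\<Union>\<K>)" if "\<forall>S\<in>\<K>. open S" for \<K> :: "'a torus set set"
    using that by (auto simp: open_torus_def vimage_Union)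
qed

end

lift_definition torus_act :: "'d::finite torus \<Rightarrow> complex^'d \<Rightarrow> complex^'d"
  is "\<lambda>t z. \<chi> r. cis (t $ r) * z $ r"
proof -
  fix s t :: "real^'d"
  assume st: "s - t \<in> period_lattice"
  have "cis (s $ r) = cis (t $ r)" for r
  proof -
    obtain k :: int where "(s - t) $ r = 2 * pi * k"
      using st unfolding period_lattice_def mem_Collect_eq by metis
    then have "s $ r = t $ r + 2 * pi * k" by (simp add: algebra_simps)
    then have "cis (s $ r) = cis (t $ r) * cis (2 * pi * k)" by (simp only: cis_mult)
    also have "cis (2 * pi * k) = 1" by (simp add: cis_multiple_2pi)
    finally show ?thesis by simp
  qed
  then show "(\<lambda>z. \<chi> r. cis (s $ r) * z $ r) = (\<lambda>z. \<chi> r. cis (t $ r) * z $ r)"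
    by simp
qed

section \<open>Labeled polytopes\<close>

text \<open>The dual space of \<open>\<real>\<^sup>n\<close> is identified with \<open>real^'n\<close> by means of the dual of the standard basis,
  so that the pairing becomes the inner product. The facets are indexed by the type \<open>'d\<close>.\<close>

record ('n::finite, 'd) facet_data =
  facet_normal :: "'d \<Rightarrow> int^'n"
  facet_label :: "'d \<Rightarrow> nat"
  facet_offset :: "'d \<Rightarrow> real"

definition conormal :: "('n::finite, 'd) facet_data \<Rightarrow> 'd \<Rightarrow> real^'n" where
  "conormal D r = (\<chi> j. real (facet_label D r) * of_int (facet_normal D r $ j))"

definition ell :: "('n::finite, 'd) facet_data \<Rightarrow> 'd \<Rightarrow> real^'n \<Rightarrow> real" where
  "ell D r x = x \<bullet> conormal D r - facet_offset D r"

definition simple_rational :: "(real^'n::finite) set \<Rightarrow> bool" where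
  "simple_rational P \<longleftrightarrow> (\<forall>p. p extreme_point_of P \<longrightarrow>
     (\<exists>(E :: 'n \<Rightarrow> (real^'n) set) (v :: 'n \<Rightarrow> int^'n).
        bij_betw E UNIV {e. e edge_of P \<and> p \<in> e} \<and>
        (\<forall>i. E i = P \<inter> {p + t *\<^sub>R (\<chi> j. of_int (v i $ j)) | t. t \<ge> 0}) \<and>
        inj v \<and>
        vec.independent (range (\<lambda>i. (\<chi> j. of_int (v i $ j)) :: rat^'n)) \<and>
        vec.span (range (\<lambda>i. (\<chi> j. of_int (v i $ j)) :: rat^'n)) = UNIV))"

definition labeled_polytope :: "(real^'n::finite) set \<Rightarrow> ('n, 'd::finite) facet_data \<Rightarrow> bool" where
  "labeled_polytope P D \<longleftrightarrow>
     polytope P \<and> interior P \<noteq> {} \<and> simple_rational P \<and>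
     (\<forall>r. facet_label D r > 0) \<and>
     (\<forall>r. Gcd (range (\<lambda>j. facet_normal D r $ j)) = 1) \<and>
     P = (\<Inter>r. {x. ell D r x \<ge> 0}) \<and>
     bij_betw (\<lambda>r. P \<inter> {x. ell D r x = 0}) UNIV {F. F facet_of P}"

section \<open>The quotient \<open>M\<^sub>P = Z / K\<close>\<close>

definition beta :: "('n::finite, 'd::finite) facet_data \<Rightarrow> real^'d \<Rightarrow> real^'n" where
  "beta D t = (\<Sum>r\<in>UNIV. t $ r *\<^sub>R conormal D r)"

lemma beta_diff: "beta D (s - t) = beta D s - beta D t"
  by (simp add: beta_def scaleR_diff_left sum_subtractf)

lemma beta_period_lattice:
  fixes D :: "('n::finite, 'd::finite) facet_data"
  assumes t: "t \<in> period_lattice"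
  shows "beta D t \<in> period_lattice"
  unfolding period_lattice_def
proof (clarify)
  fix i
  obtain k :: "'d \<Rightarrow> int" where "\<And>r. t $ r = 2 * pi * of_int (k r)"
    using t unfolding period_lattice_def mem_Collect_eq by metis
  then have "beta D t $ i =
      2 * pi * of_int (\<Sum>r\<in>UNIV. k r * (int (facet_label D r) * facet_normal D r $ i))"
    by (simp add: beta_def conormal_def sum_distrib_left mult.assoc)
  then show "\<exists>k::int. beta D t $ i = 2 * pi * k" ..
qed

lift_definition torus_hom :: "('n::finite, 'd::finite) facet_data \<Rightarrow> 'd torus \<Rightarrow> 'n torus" is beta
  by (metis beta_diff beta_period_lattice)

definition K :: "('n::finite, 'd::finite) facet_data \<Rightarrow> 'd torus set" where
  "K D = {t. torus_hom D t = 0}"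

definition Lie_K :: "('n::finite, 'd::finite) facet_data \<Rightarrow> (real^'d) set" where
  "Lie_K D = {\<xi>. beta D \<xi> = 0}"

definition phi_T :: "('n::finite, 'd::finite) facet_data \<Rightarrow> complex^'d \<Rightarrow> real^'d" where
  "phi_T D z = (\<chi> r. (norm (z $ r))\<^sup>2 / 2 + facet_offset D r)"

definition phi_K :: "('n::finite, 'd::finite) facet_data \<Rightarrow> complex^'d \<Rightarrow> real^'d \<Rightarrow> real" where
  "phi_K D z = (\<lambda>\<xi>\<in>Lie_K D. phi_T D z \<bullet> \<xi>)"

definition Z :: "('n::finite, 'd::finite) facet_data \<Rightarrow> (complex^'d) set" where
  "Z D = {z. \<forall>\<xi>\<in>Lie_K D. phi_K D z \<xi> = 0}"

definition proj :: "('n::finite, 'd::finite) facet_data \<Rightarrow> complex^'d \<Rightarrow> (complex^'d) set" where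
  "proj D z = {torus_act t z | t. t \<in> K D}"

definition M :: "('n::finite, 'd::finite) facet_data \<Rightarrow> (complex^'d) set set" where
  "M D = proj D ` Z D"

definition M_top :: "('n::finite, 'd::finite) facet_data \<Rightarrow> (complex^'d) set topology" where
  "M_top D = topology (\<lambda>V. V \<subseteq> M D \<and> openin (top_of_set (Z D)) {z \<in> Z D. proj D z \<in> V})"

lemma openin_M_top:
  "openin (M_top D) V \<longleftrightarrow> V \<subseteq> M D \<and> openin (top_of_set (Z D)) {z \<in> Z D. proj D z \<in> V}"
proof -
  have "istopology (\<lambda>V. V \<subseteq> M D \<and> openin (top_of_set (Z D)) {z \<in> Z D. proj D z \<in> V})"
    unfolding istopology_def
  proof (intro conjI allI impI)
    fix S T
    assume "S \<subseteq> M D \<and> openin (top_of_set (Z D)) {z \<in> Z D. proj D z \<in> S}"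
      "T \<subseteq> M D \<and> openin (top_of_set (Z D)) {z \<in> Z D. proj D z \<in> T}"
    moreover have "{z \<in> Z D. proj D z \<in> S \<inter> T} =
        {z \<in> Z D. proj D z \<in> S} \<inter> {z \<in> Z D. proj D z \<in> T}" by blast
    ultimately show "S \<inter> T \<subseteq> M D" "openin (top_of_set (Z D)) {z \<in> Z D. proj D z \<in> S \<inter> T}"
      by auto
  next
    fix \<K>
    assume *: "\<forall>S\<in>\<K>. S \<subseteq> M D \<and> openin (top_of_set (Z D)) {z \<in> Z D. proj D z \<in> S}"
    then show "\<Union>\<K> \<subseteq> M D" by blast
    have "{z \<in> Z D. proj D z \<in> \<Union>\<K>} = \<Union>((\<lambda>S. {z \<in> Z D. proj D z \<in> S}) ` \<K>)" by blast
    with * show "openin (top_of_set (Z D)) {z \<in> Z D. proj D z \<in> \<Union>\<K>}" by auto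
  qed
  then show ?thesis by (simp add: M_top_def topology_inverse')
qed

definition phi_P :: "('n::finite, 'd::finite) facet_data \<Rightarrow> (complex^'d) set \<Rightarrow> real^'n" where
  "phi_P D p = (THE x. \<exists>z\<in>Z D. proj D z = p \<and> adjoint (beta D) x = phi_T D z)"

definition M_open :: "('n::finite, 'd::finite) facet_data \<Rightarrow> (real^'n) set \<Rightarrow> (complex^'d) set set" where
  "M_open D P = {p \<in> M D. phi_P D p \<in> interior P}"

text \<open>The action of \<open>s\<close> in the \<open>n\<close>-torus, identified with the quotient of the \<open>d\<close>-torus by \<open>K\<close>.\<close>

definition tau :: "('n::finite, 'd::finite) facet_data \<Rightarrow> 'n torus \<Rightarrow> (complex^'d) set \<Rightarrow> (complex^'d) set" where
  "tau D s p = (THE q. \<exists>t. \<exists>z\<in>Z D. torus_hom D t = s \<and> proj D z = p \<and> q = proj D (torus_act t z))"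

section \<open>Tangent vectors of the quotient and the reduced structures\<close>

text \<open>The symplectic form \<open>\<Sum>\<^sub>r du\<^sub>r \<and> dv\<^sub>r\<close> and the complex structure of \<open>\<complex>\<^sup>d\<close>. The metric
  \<open>std_form a (std_J b)\<close> is the inner product of \<open>complex^'d\<close>.\<close>

definition std_form :: "complex^'d::finite \<Rightarrow> complex^'d \<Rightarrow> real" where
  "std_form a b = (\<Sum>r\<in>UNIV. Re (a $ r) * Im (b $ r) - Im (a $ r) * Re (b $ r))"

definition std_J :: "complex^'d::finite \<Rightarrow> complex^'d" where
  "std_J a = (\<chi> r. \<i> * a $ r)"

definition generator :: "real^'d::finite \<Rightarrow> complex^'d \<Rightarrow> complex^'d" where
  "generator \<xi> z = vector_derivative (\<lambda>s. torus_act (torus_class (s *\<^sub>R \<xi>)) z) (at 0)"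

definition tangent_Z :: "('n::finite, 'd::finite) facet_data \<Rightarrow> complex^'d \<Rightarrow> (complex^'d) set" where
  "tangent_Z D z = {v. \<forall>\<xi>\<in>Lie_K D. frechet_derivative (\<lambda>y. phi_K D y \<xi>) (at z) v = 0}"

definition horizontal :: "('n::finite, 'd::finite) facet_data \<Rightarrow> complex^'d \<Rightarrow> (complex^'d) set" where
  "horizontal D z = {v \<in> tangent_Z D z. \<forall>\<xi>\<in>Lie_K D. v \<bullet> generator \<xi> z = 0}"

text \<open>A tangent vector of \<open>M = Z / K\<close> is an orbit of the action of the tangent group \<open>TK\<close> on \<open>TZ\<close>,
  that is, a point of \<open>TZ / TK\<close>. As \<open>torus_act t\<close> is linear, it is its own derivative. The projection
  \<open>dproj D z\<close> has kernel \<open>{generator \<xi> z | \<xi>. \<xi> \<in> Lie_K D}\<close> wherever the stabilizer of \<open>z\<close> in \<open>K\<close> is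
  trivial, which holds over the interior of the polytope; the definite descriptions below
  are only used there.\<close>

type_synonym 'd tangent = "((complex^'d) \<times> (complex^'d)) set"

definition dproj :: "('n::finite, 'd::finite) facet_data \<Rightarrow> complex^'d \<Rightarrow> complex^'d \<Rightarrow> 'd tangent" where
  "dproj D z v = {(torus_act t z, torus_act t v + generator \<xi> (torus_act t z)) | t \<xi>.
     t \<in> K D \<and> \<xi> \<in> Lie_K D}"

definition omega_P :: "('n::finite, 'd::finite) facet_data \<Rightarrow> 'd tangent \<Rightarrow> 'd tangent \<Rightarrow> real" where
  "omega_P D A B = (THE c. \<exists>z\<in>Z D. \<exists>a\<in>tangent_Z D z. \<exists>b\<in>tangent_Z D z.
     A = dproj D z a \<and> B = dproj D z b \<and> c = std_form a b)"

definition J_P :: "('n::finite, 'd::finite) facet_data \<Rightarrow> 'd tangent \<Rightarrow> 'd tangent" where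
  "J_P D A = (THE B. \<exists>z\<in>Z D. \<exists>a\<in>horizontal D z. A = dproj D z a \<and> B = dproj D z (std_J a))"

text \<open>The tangent vectors \<open>F i\<close> have to be based at a common point of \<open>M\<close>.\<close>

definition lin_comb :: "('n::finite, 'd::finite) facet_data \<Rightarrow> ('i::finite \<Rightarrow> real) \<Rightarrow> ('i \<Rightarrow> 'd tangent) \<Rightarrow> 'd tangent" where
  "lin_comb D c F = (THE A. \<exists>z\<in>Z D. \<exists>a. (\<forall>i. a i \<in> tangent_Z D z \<and> F i = dproj D z (a i)) \<and>
     A = dproj D z (\<Sum>i\<in>UNIV. c i *\<^sub>R a i))"

text \<open>The velocity at time \<open>0\<close> of a curve in \<open>M\<close>, computed from a lift to \<open>Z\<close>.\<close>

definition velocity :: "('n::finite, 'd::finite) facet_data \<Rightarrow> (real \<Rightarrow> (complex^'d) set) \<Rightarrow> 'd tangent" where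
  "velocity D c = (THE A. \<exists>\<gamma> v. (\<forall>\<^sub>F t in nhds 0. \<gamma> t \<in> Z D \<and> proj D (\<gamma> t) = c t) \<and>
     (\<gamma> has_vector_derivative v) (at 0) \<and> A = dproj D (\<gamma> 0) v)"

section \<open>Symplectic coordinates\<close>

text \<open>Smooth functions on an open subset of \<open>M\<close> are those which pull back to smooth functions on \<open>Z\<close>,
  that is, locally to restrictions of smooth functions on \<open>\<complex>\<^sup>d\<close>.\<close>

definition smooth_on_M :: "('n::finite, 'd::finite) facet_data \<Rightarrow> (complex^'d) set set \<Rightarrow> ((complex^'d) set \<Rightarrow> real) \<Rightarrow> bool" where
  "smooth_on_M D V f \<longleftrightarrow> (\<forall>z\<in>Z D. proj D z \<in> V \<longrightarrow>
     (\<exists>W h. open W \<and> z \<in> W \<and> smooth_on W h \<and>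
       (\<forall>y\<in>W \<inter> Z D. proj D y \<in> V \<longrightarrow> h y = f (proj D y))))"

definition smooth_on_prod :: "((real^'n::finite) \<times> 'n torus) set \<Rightarrow> ((real^'n) \<times> 'n torus \<Rightarrow> real) \<Rightarrow> bool" where
  "smooth_on_prod U f \<longleftrightarrow>
     smooth_on {(x, t). (x, torus_class t) \<in> U} (\<lambda>(x, t). f (x, torus_class t))"

definition coord_diffeo :: "('n::finite, 'd::finite) facet_data \<Rightarrow> (real^'n) set \<Rightarrow>
    ((real^'n) \<times> 'n torus \<Rightarrow> (complex^'d) set) \<Rightarrow> bool" where
  "coord_diffeo D P \<Psi> \<longleftrightarrow>
     homeomorphic_map (top_of_set (interior P \<times> UNIV)) (subtopology (M_top D) (M_open D P)) \<Psi> \<and>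
     (\<forall>V f. openin (subtopology (M_top D) (M_open D P)) V \<longrightarrow>
        (smooth_on_M D V f \<longleftrightarrow>
         smooth_on_prod {y \<in> interior P \<times> UNIV. \<Psi> y \<in> V} (f \<circ> \<Psi>)))"

text \<open>The coordinate frame at \<open>\<Psi> (x, \<theta>)\<close>: \<open>Inl j\<close> is \<open>\<partial>/\<partial>x\<^sub>j\<close> and \<open>Inr j\<close> is \<open>\<partial>/\<partial>\<theta>\<^sub>j\<close>.\<close>

definition frame :: "('n::finite, 'd::finite) facet_data \<Rightarrow> ((real^'n) \<times> 'n torus \<Rightarrow> (complex^'d) set) \<Rightarrow>
    real^'n \<Rightarrow> 'n torus \<Rightarrow> 'n + 'n \<Rightarrow> 'd tangent" where
  "frame D \<Psi> x \<theta> i = (case i of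
       Inl j \<Rightarrow> velocity D (\<lambda>s. \<Psi> (x + s *\<^sub>R axis j 1, \<theta>))
     | Inr j \<Rightarrow> velocity D (\<lambda>s. \<Psi> (x, \<theta> + torus_class (s *\<^sub>R axis j 1))))"

text \<open>The components of \<open>\<Sum>\<^sub>j dx\<^sub>j \<and> d\<theta>\<^sub>j\<close> in the coordinate frame.\<close>

definition darboux :: "'n + 'n \<Rightarrow> 'n + 'n \<Rightarrow> real" where
  "darboux i j = (case (i, j) of
       (Inl a, Inr b) \<Rightarrow> if a = b then 1 else 0
     | (Inr a, Inl b) \<Rightarrow> if a = b then -1 else 0
     | _ \<Rightarrow> 0)"

definition symplectic_coordinates :: "('n::finite, 'd::finite) facet_data \<Rightarrow> (real^'n) set \<Rightarrow>
    ((real^'n) \<times> 'n torus \<Rightarrow> (complex^'d) set) \<Rightarrow> bool" where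
  "symplectic_coordinates D P \<Psi> \<longleftrightarrow>
     coord_diffeo D P \<Psi> \<and>
     (\<forall>x\<in>interior P. \<forall>\<theta>. phi_P D (\<Psi> (x, \<theta>)) = x) \<and>
     (\<forall>x\<in>interior P. \<forall>\<theta> s. \<Psi> (x, s + \<theta>) = tau D s (\<Psi> (x, \<theta>))) \<and>
     (\<forall>x\<in>interior P. \<forall>\<theta> i j. omega_P D (frame D \<Psi> x \<theta> i) (frame D \<Psi> x \<theta> j) = darboux i j)"

definition represents_J :: "('n::finite, 'd::finite) facet_data \<Rightarrow> ((real^'n) \<times> 'n torus \<Rightarrow> (complex^'d) set) \<Rightarrow>
    real^'n \<Rightarrow> 'n torus \<Rightarrow> real^('n + 'n)^('n + 'n) \<Rightarrow> bool" where
  "represents_J D \<Psi> x \<theta> A \<longleftrightarrow>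
     (\<forall>j. J_P D (frame D \<Psi> x \<theta> j) = lin_comb D (\<lambda>i. A $ i $ j) (frame D \<Psi> x \<theta>))"

definition block_matrix :: "real^'n^'n \<Rightarrow> real^'n^'n \<Rightarrow> real^'n^'n \<Rightarrow> real^'n^'n \<Rightarrow>
    real^('n::finite + 'n)^('n + 'n)" where
  "block_matrix A B C E = (\<chi> i j. case (i, j) of
       (Inl a, Inl b) \<Rightarrow> A $ a $ b
     | (Inl a, Inr b) \<Rightarrow> B $ a $ b
     | (Inr a, Inl b) \<Rightarrow> C $ a $ b
     | (Inr a, Inr b) \<Rightarrow> E $ a $ b)"

definition g_P :: "('n::finite, 'd::finite) facet_data \<Rightarrow> real^'n \<Rightarrow> real" where
  "g_P D x = (1/2) * (\<Sum>r\<in>UNIV. ell D r x * ln (ell D r x))"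

end

theory Submission
  imports Defs
begin

text \<open>
  The level set \<open>Z\<close> consists of the \<open>z\<close> with \<open>|z\<^sub>r|\<^sup>2 = 2 ell\<^sub>r(x)\<close> for some \<open>x\<close> in \<open>P\<close>, so that
  \<open>x \<mapsto> (\<surd>(2 ell\<^sub>r(x)))\<^sub>r\<close> is a section of the moment map, and moving it by the torus gives the
  symplectic coordinates. At \<open>(x, 0)\<close> the vector \<open>\<partial>/\<partial>x\<^sub>j\<close> has the real lift \<open>(c\<^sub>r\<^sub>j / \<surd>(2 ell\<^sub>r(x)))\<^sub>r\<close>, where
  \<open>c\<^sub>r\<close> is the conormal. This lift is horizontal, and \<open>\<i>\<close> maps it to the generator of
  \<open>\<zeta>\<^sub>j = (c\<^sub>r\<^sub>j / (2 ell\<^sub>r(x)))\<^sub>r\<close>. The image of \<open>\<zeta>\<^sub>j\<close> under \<open>beta\<close> has the components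
  \<open>\<Sum>\<^sub>r c\<^sub>r\<^sub>k c\<^sub>r\<^sub>j / (2 ell\<^sub>r(x))\<close>, which form the \<open>j\<close>-th column of the Hessian of \<open>g\<^sub>P\<close>.
\<close>

section \<open>Calculus of smooth functions\<close>

text \<open>The structures on the quotient are definite descriptions over lifts to
  \<open>Z D\<close>, so their values have to be shown independent of the lift. Over the interior of
  \<open>P\<close> every coordinate of a point of \<open>Z D\<close> is nonzero, hence the whole
  d-torus acts freely there. Two lifts of a family of tangent vectors at one point then differ by a
  single element of \<open>K D\<close> and by generators of \<open>Lie_K D\<close>, and these
  ambiguities cancel.

  The complex structure can only be read off from horizontal lifts. Every vector that
  \<open>beta\<close> maps to \<open>axis j 1\<close> generates a lift of
  \<partial>/\<partial>\<theta>_j; a horizontal one is the combination of the \<zeta>'s with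
  coefficients from the inverse Hessian. This is the origin of G^{-1} in the matrix, and J on these
  vectors follows from J^2 = -1.

  The Darboux form of the frame is checked by hand: over the real points \<open>root_point x\<close>
  the lifts of the \<partial>/\<partial>x_j are real and those of the
  \<partial>/\<partial>\<theta>_j imaginary, so that both families are isotropic, and the mixed
  entries come from the moment map identity.\<close>

lemma C_k_on_cong:
  assumes "open U" "\<And>x. x \<in> U \<Longrightarrow> f x = g x" "C_k_on k U f"
  shows "C_k_on k U g"
  using assms(2,3)
proof (induction k arbitrary: f g)
  case 0
  then show ?case by (metis C_k_on.simps(1) continuous_on_cong)
next
  case (Suc k)
  have diff: "f differentiable (at x)" if "x \<in> U" for x using Suc.prems that by simp
  have "g differentiable (at x)" if "x \<in> U" for x
    using diff[OF that] has_derivative_transform_within_open[of f _ x UNIV U g] \<open>open U\<close> that Suc.prems(1)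
    unfolding differentiable_def by blast
  moreover have "C_k_on k U (\<lambda>x. frechet_derivative g (at x) v)" for v
  proof (rule Suc.IH)
    show "C_k_on k U (\<lambda>x. frechet_derivative f (at x) v)" using Suc.prems by simp
    show "frechet_derivative f (at x) v = frechet_derivative g (at x) v" if "x \<in> U" for x
      using frechet_derivative_transform_within_open[OF diff \<open>open U\<close> that Suc.prems(1)] that
      by simp
  qed
  ultimately show ?case by simp
qed

text \<open>The introduction rule of almost every induction below: a formula for the derivative may
  stand for \<open>frechet_derivative\<close>, which equals it on \<open>U\<close> and is then
  exchanged by \<open>C_k_on_cong\<close>.\<close>

lemma C_k_on_SucI:
  assumes "open U" "\<And>x. x \<in> U \<Longrightarrow> (f has_derivative f' x) (at x)"
    "\<And>v. C_k_on k U (\<lambda>x. f' x v)"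
  shows "C_k_on (Suc k) U f"
proof -
  have "C_k_on k U (\<lambda>x. frechet_derivative f (at x) v)" for v
    by (rule C_k_on_cong[OF \<open>open U\<close> _ assms(3)]) (simp add: frechet_derivative_at[OF assms(2), symmetric])
  then show ?thesis using assms(2) by (auto simp: differentiable_def)
qed

lemma C_k_on_Suc_has_derivative:
  assumes "C_k_on (Suc k) U f" "x \<in> U"
  shows "(f has_derivative frechet_derivative f (at x)) (at x)"
  using assms by (simp add: frechet_derivative_works)

lemma C_k_on_mono: "C_k_on k V f \<Longrightarrow> U \<subseteq> V \<Longrightarrow> C_k_on k U f"
  by (induction k arbitrary: f) (auto intro: continuous_on_subset)

lemma C_k_on_Suc_imp: "C_k_on (Suc k) U f \<Longrightarrow> C_k_on k U f"
proof (induction k arbitrary: f)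
  case 0
  then show ?case
    by (auto intro!: continuous_at_imp_continuous_on differentiable_imp_continuous_within)
next
  case (Suc k)
  then show ?case by (metis C_k_on.simps(2))
qed

text \<open>Regularity is a local property. This lets the locally chosen extensions in
  \<open>smooth_on_M\<close> give smoothness on a whole coordinate domain.\<close>

lemma C_k_on_locally:
  assumes "\<And>x. x \<in> U \<Longrightarrow> \<exists>W. open W \<and> x \<in> W \<and> C_k_on k W f"
  shows "C_k_on k U f"
  using assms
proof (induction k arbitrary: f)
  case 0
  then show ?case
    by (auto intro!: continuous_at_imp_continuous_on dest: continuous_on_interior simp: interior_open)
       (metis continuous_on_eq_continuous_at)
next
  case (Suc k)
  show ?case
    unfolding C_k_on.simps
  proof (intro conjI ballI allI)
    show "f differentiable (at x)" if "x \<in> U" for x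
      using Suc.prems[OF that] by auto
    show "C_k_on k U (\<lambda>x. frechet_derivative f (at x) v)" for v
      by (rule Suc.IH) (metis C_k_on.simps(2) Suc.prems)
  qed
qed

lemma C_k_on_const: "C_k_on k U (\<lambda>x. c)"
  by (induction k arbitrary: c) auto

lemma C_k_on_bounded_linear_comp:
  assumes "bounded_linear L" "open U" "C_k_on k U f"
  shows "C_k_on k U (\<lambda>x. L (f x))"
  using assms(3)
proof (induction k arbitrary: f)
  case 0
  then show ?case
    by (auto intro: bounded_linear.continuous_on[OF assms(1)])
next
  case (Suc k)
  show ?case
    by (rule C_k_on_SucI[OF \<open>open U\<close> bounded_linear.has_derivative[OF assms(1) C_k_on_Suc_has_derivative[OF Suc.prems]]])
       (use Suc in auto)
qed

lemma C_k_on_bounded_linear: "bounded_linear L \<Longrightarrow> open U \<Longrightarrow> C_k_on k U L"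
proof (cases k)
  case (Suc l)
  assume L: "bounded_linear L" "open U"
  show ?thesis unfolding Suc
    by (rule C_k_on_SucI[OF L(2) bounded_linear_imp_has_derivative[OF L(1)] C_k_on_const])
qed (simp add: linear_continuous_on)

lemma C_k_on_add:
  assumes "open U" "C_k_on k U f" "C_k_on k U g"
  shows "C_k_on k U (\<lambda>x. f x + g x)"
  using assms(2,3)
proof (induction k arbitrary: f g)
  case (Suc k)
  show ?case
    by (rule C_k_on_SucI[OF \<open>open U\<close> has_derivative_add[OF Suc.prems[THEN C_k_on_Suc_has_derivative]]])
       (use Suc in auto)
qed (auto intro: continuous_on_add)

lemma C_k_on_sum:
  assumes "open U" "finite I" "\<And>i. i \<in> I \<Longrightarrow> C_k_on k U (f i)"
  shows "C_k_on k U (\<lambda>x. \<Sum>i\<in>I. f i x)"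
  using assms(2,3) by (induction I rule: finite_induct) (simp_all add: C_k_on_const C_k_on_add[OF \<open>open U\<close>])

text \<open>The product rule gives two terms of the same shape, so the induction closes once
  \<open>f\<close> and \<open>g\<close> themselves are known to be of the lower class.\<close>

lemma C_k_on_bilinear:
  assumes "bounded_bilinear h" "open U" "C_k_on k U f" "C_k_on k U g"
  shows "C_k_on k U (\<lambda>x. h (f x) (g x))"
  using assms(3,4)
proof (induction k arbitrary: f g)
  case 0
  then show ?case by (auto intro: bounded_bilinear.continuous_on[OF assms(1)])
next
  case (Suc k)
  have "C_k_on k U f" "C_k_on k U g" using Suc.prems C_k_on_Suc_imp by blast+
  moreover have "C_k_on k U (\<lambda>x. frechet_derivative f (at x) v)"
    "C_k_on k U (\<lambda>x. frechet_derivative g (at x) v)" for v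
    using Suc.prems by simp_all
  ultimately show ?case
    by (intro C_k_on_SucI[OF \<open>open U\<close> bounded_bilinear.FDERIV[OF assms(1) Suc.prems[THEN C_k_on_Suc_has_derivative]]]
        C_k_on_add[OF \<open>open U\<close>] Suc.IH)
qed

lemma C_k_on_compose:
  fixes f :: "'a::real_normed_vector \<Rightarrow> 'b::euclidean_space"
    and g :: "'b \<Rightarrow> 'c::real_normed_vector"
  assumes "open U" "open W" "f ` U \<subseteq> W" "C_k_on k U f" "C_k_on k W g"
  shows "C_k_on k U (\<lambda>x. g (f x))"
  using assms(4,5)
proof (induction k arbitrary: g)
  case 0
  then show ?case using assms(3) by (auto intro: continuous_on_compose2)
next
  case (Suc k)
  let ?f' = "\<lambda>x. frechet_derivative f (at x)" and ?g' = "\<lambda>x. frechet_derivative g (at x)"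
  have g': "(g has_derivative ?g' (f x)) (at (f x))" if "x \<in> U" for x
    using C_k_on_Suc_has_derivative[OF Suc.prems(2)] assms(3) that by blast
  \<comment> \<open>The chain rule evaluates the derivative of \<open>g\<close> in a direction that
    varies with \<open>x\<close>, while \<open>C_k_on\<close> speaks of fixed directions. Expanding
    in \<open>Basis\<close> leaves products of coordinates of \<open>?f'\<close> with derivatives of
    \<open>g\<close> in fixed directions; hence the Euclidean intermediate space.\<close>
  have "((\<lambda>x. g (f x)) has_derivative (\<lambda>v. \<Sum>b\<in>Basis. (?f' x v \<bullet> b) *\<^sub>R ?g' (f x) b)) (at x)"
    if x: "x \<in> U" for x
  proof -
    have "((\<lambda>x. g (f x)) has_derivative (\<lambda>v. ?g' (f x) (?f' x v))) (at x)"
      by (rule has_derivative_compose[OF C_k_on_Suc_has_derivative[OF Suc.prems(1) x] g'[OF x]])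
    moreover have "?g' (f x) w = (\<Sum>b\<in>Basis. (w \<bullet> b) *\<^sub>R ?g' (f x) b)" for w
    proof -
      have "linear (?g' (f x))" using g'[OF x] has_derivative_linear by blast
      then have "?g' (f x) (\<Sum>b\<in>Basis. (w \<bullet> b) *\<^sub>R b) = (\<Sum>b\<in>Basis. (w \<bullet> b) *\<^sub>R ?g' (f x) b)"
        by (simp only: linear_sum linear_scale)
      then show ?thesis by (simp only: euclidean_representation)
    qed
    then have "(\<lambda>v. ?g' (f x) (?f' x v)) = (\<lambda>v. \<Sum>b\<in>Basis. (?f' x v \<bullet> b) *\<^sub>R ?g' (f x) b)"
      by (rule ext)
    ultimately show ?thesis by (rule has_derivative_eq_rhs)
  qed
  moreover have "C_k_on k U (\<lambda>x. (?f' x v \<bullet> b) *\<^sub>R ?g' (f x) b)" for v b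
  proof (rule C_k_on_bilinear[OF bounded_bilinear_scaleR \<open>open U\<close>])
    show "C_k_on k U (\<lambda>x. ?f' x v \<bullet> b)"
      using Suc.prems(1)
      by (intro C_k_on_bounded_linear_comp[OF bounded_linear_inner_left \<open>open U\<close>]) auto
    show "C_k_on k U (\<lambda>x. ?g' (f x) b)"
      using Suc.prems by (intro Suc.IH[of "\<lambda>y. ?g' y b"] C_k_on_Suc_imp[of k U f]) auto
  qed
  ultimately show ?case
    by (intro C_k_on_SucI[OF \<open>open U\<close>, where f' = "\<lambda>x v. \<Sum>b\<in>Basis. (?f' x v \<bullet> b) *\<^sub>R ?g' (f x) b"]
        C_k_on_sum[OF \<open>open U\<close>]) auto
qed

lemma smooth_on_mono: "smooth_on V f \<Longrightarrow> U \<subseteq> V \<Longrightarrow> smooth_on U f"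
  unfolding smooth_on_def using C_k_on_mono by blast

lemma smooth_on_locally:
  assumes "\<And>x. x \<in> U \<Longrightarrow> \<exists>W. open W \<and> x \<in> W \<and> smooth_on W f"
  shows "smooth_on U f"
  unfolding smooth_on_def using C_k_on_locally assms unfolding smooth_on_def by metis

lemma smooth_on_imp_continuous_on: "smooth_on U f \<Longrightarrow> continuous_on U f"
  unfolding smooth_on_def by (metis C_k_on.simps(1))

lemma smooth_on_cong:
  "open U \<Longrightarrow> smooth_on U f \<Longrightarrow> (\<And>x. x \<in> U \<Longrightarrow> f x = g x) \<Longrightarrow> smooth_on U g"
  unfolding smooth_on_def using C_k_on_cong by blast

lemma smooth_on_const: "smooth_on U (\<lambda>x. c)"
  unfolding smooth_on_def by (simp add: C_k_on_const)

lemma smooth_on_bounded_linear: "bounded_linear L \<Longrightarrow> open U \<Longrightarrow> smooth_on U L"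
  unfolding smooth_on_def by (simp add: C_k_on_bounded_linear)

lemma smooth_on_bounded_linear_comp:
  "bounded_linear L \<Longrightarrow> open U \<Longrightarrow> smooth_on U f \<Longrightarrow> smooth_on U (\<lambda>x. L (f x))"
  unfolding smooth_on_def by (simp add: C_k_on_bounded_linear_comp)

lemma smooth_on_add:
  "open U \<Longrightarrow> smooth_on U f \<Longrightarrow> smooth_on U g \<Longrightarrow> smooth_on U (\<lambda>x. f x + g x)"
  unfolding smooth_on_def by (simp add: C_k_on_add)

lemma smooth_on_sum:
  "open U \<Longrightarrow> finite I \<Longrightarrow> (\<And>i. i \<in> I \<Longrightarrow> smooth_on U (f i)) \<Longrightarrow> smooth_on U (\<lambda>x. \<Sum>i\<in>I. f i x)"
  unfolding smooth_on_def by (simp add: C_k_on_sum)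

lemma smooth_on_bilinear:
  "bounded_bilinear h \<Longrightarrow> open U \<Longrightarrow> smooth_on U f \<Longrightarrow> smooth_on U g \<Longrightarrow> smooth_on U (\<lambda>x. h (f x) (g x))"
  unfolding smooth_on_def by (simp add: C_k_on_bilinear)

lemmas smooth_on_scaleR = smooth_on_bilinear[OF bounded_bilinear_scaleR]
lemmas smooth_on_mult = smooth_on_bilinear[OF bounded_bilinear_mult]
lemmas smooth_on_inner = smooth_on_bilinear[OF bounded_bilinear_inner]

lemma smooth_on_compose:
  fixes f :: "'a::real_normed_vector \<Rightarrow> 'b::euclidean_space"
  assumes "open U" "open W" "f ` U \<subseteq> W" "smooth_on U f" "smooth_on W g"
  shows "smooth_on U (\<lambda>x. g (f x))"
  using assms C_k_on_compose unfolding smooth_on_def by blast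

section \<open>Vector-valued maps and elementary functions\<close>

lemma norm_axis_eq: "norm (axis i x :: 'a::real_normed_vector^'n::finite) = norm x"
  by (simp add: norm_vec_def axis_def L2_set_def if_distrib[of norm] if_distrib[of "\<lambda>x. x\<^sup>2"] cong: if_cong)

lemma bounded_linear_axis: "bounded_linear (axis i :: 'a::real_normed_vector \<Rightarrow> 'a^'n::finite)"
  by (rule bounded_linear_intro[where K = 1])
     (simp_all add: norm_axis_eq, simp_all add: vec_eq_iff axis_def)

lemma smooth_on_vec_lambda:
  fixes f :: "'n::finite \<Rightarrow> 'a::real_normed_vector \<Rightarrow> 'b::real_normed_vector"
  assumes "open U" "\<And>i. smooth_on U (f i)"
  shows "smooth_on U (\<lambda>x. \<chi> i. f i x)"
proof -
  have "(\<lambda>x. \<chi> i. f i x) = (\<lambda>x. \<Sum>i\<in>UNIV. axis i (f i x))"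
    by (simp add: fun_eq_iff vec_eq_iff axis_def)
  then show ?thesis
    using assms by (simp only:) (intro smooth_on_sum smooth_on_bounded_linear_comp[OF bounded_linear_axis]; simp)
qed

lemma smooth_on_Pair:
  fixes f :: "'a::real_normed_vector \<Rightarrow> 'b::real_normed_vector" and g :: "'a \<Rightarrow> 'c::real_normed_vector"
  assumes "open U" "smooth_on U f" "smooth_on U g"
  shows "smooth_on U (\<lambda>x. (f x, g x))"
proof -
  have "smooth_on U (\<lambda>x. (f x, 0) + (0, g x))"
    using assms
    by (intro smooth_on_add smooth_on_bounded_linear_comp[of "\<lambda>y. (y, 0)"]
        smooth_on_bounded_linear_comp[of "\<lambda>y. (0, y)"])
       (auto intro!: bounded_linear_Pair bounded_linear_ident bounded_linear_zero)
  then show ?thesis by simp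
qed

text \<open>The constant and the exponent vary so that the family is closed under differentiation;
  the square root and the derivative of \<open>ln\<close> are members. \<open>C_k_on_cis\<close> and
  \<open>C_k_on_inverse_complex\<close> carry a constant for the same reason.\<close>

lemma C_k_on_powr: "C_k_on k {0<..} (\<lambda>x::real. c * x powr a)"
proof (induction k arbitrary: c a)
  case 0
  then show ?case by (auto intro!: continuous_intros)
next
  case (Suc k)
  show ?case
  proof (rule C_k_on_SucI)
    show "((\<lambda>x. c * x powr a) has_derivative (\<lambda>v. (v * (c * a)) * x powr (a - 1))) (at x)"
      if "x \<in> {0<..}" for x :: real
      using that by (auto intro!: derivative_eq_intros simp: powr_diff algebra_simps)
  qed (use Suc in auto)
qed

lemma smooth_on_sqrt: "smooth_on {0<..} sqrt"
  unfolding smooth_on_def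
  by (rule allI, rule C_k_on_cong[OF _ _ C_k_on_powr[of _ 1 "1/2"]]) (auto simp: powr_half_sqrt)

lemma smooth_on_ln: "smooth_on {0<..} (ln :: real \<Rightarrow> real)"
  unfolding smooth_on_def
proof
  show "C_k_on k {0<..} (ln :: real \<Rightarrow> real)" for k
  proof (cases k)
    case (Suc l)
    show ?thesis
      unfolding Suc
    proof (rule C_k_on_SucI)
      show "(ln has_derivative (\<lambda>v. v * x powr -1)) (at x)" if "x \<in> {0<..}" for x :: real
        using that by (auto intro!: derivative_eq_intros simp: powr_minus divide_simps)
      show "C_k_on l {0<..} (\<lambda>x. v * x powr -1)" for v :: real
        by (rule C_k_on_powr)
    qed simp
  qed (auto intro!: continuous_intros)
qed

lemma C_k_on_cis: "C_k_on k UNIV (\<lambda>t. c * cis t)"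
proof (induction k arbitrary: c)
  case 0
  then show ?case by (auto intro!: continuous_intros)
next
  case (Suc k)
  show ?case
  proof (rule C_k_on_SucI)
    show "((\<lambda>t. c * cis t) has_derivative (\<lambda>v. (v * \<i> * c) * cis t)) (at t)" for t
    proof -
      have "((\<lambda>z. c * exp (\<i> * z)) has_field_derivative \<i> * c * cis t) (at (of_real t))"
        by (auto intro!: derivative_eq_intros simp: cis_conv_exp)
      then have "((\<lambda>t. c * cis t) has_vector_derivative \<i> * c * cis t) (at t)"
        by (auto dest: has_vector_derivative_real_field simp: cis_conv_exp)
      then show ?thesis
        by (simp add: has_vector_derivative_def scaleR_conv_of_real mult_ac)
    qed
  qed (use Suc in auto)
qed

lemma smooth_on_cis: "smooth_on UNIV cis"
  unfolding smooth_on_def using C_k_on_cis[of _ 1] by simp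

lemma C_k_on_inverse_complex: "C_k_on k (- {0}) (\<lambda>z::complex. c * inverse z ^ m)"
proof (induction k arbitrary: c m)
  case 0
  then show ?case by (auto intro!: continuous_intros)
next
  case (Suc k)
  show ?case
  proof (rule C_k_on_SucI)
    show "((\<lambda>z. c * inverse z ^ m) has_derivative (\<lambda>v. (- (of_nat m * c * v)) * inverse z ^ Suc m)) (at z)"
      if "z \<in> - {0}" for z :: complex
    proof -
      have "((\<lambda>z. c * inverse z ^ m) has_field_derivative (- (of_nat m * c)) * inverse z ^ Suc m) (at z)"
      proof (cases m)
        case (Suc l)
        with that show ?thesis
          by (auto intro!: DERIV_cmult[THEN DERIV_cong] DERIV_power_Suc DERIV_inverse simp del: power_Suc)
            (simp add: field_simps)
      qed (auto intro!: derivative_eq_intros)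
      then show ?thesis
        by (auto simp: has_field_derivative_def algebra_simps elim!: has_derivative_eq_rhs)
    qed
    show "C_k_on k (- {0}) (\<lambda>z. (- (of_nat m * c * v)) * inverse z ^ Suc m)" for v
      by (rule Suc)
  qed auto
qed

lemma smooth_on_Ln: "smooth_on (- \<real>\<^sub>\<le>\<^sub>0) Ln"
  unfolding smooth_on_def
proof
  have op: "open (- \<real>\<^sub>\<le>\<^sub>0 :: complex set)" by (simp add: open_Compl)
  show "C_k_on k (- \<real>\<^sub>\<le>\<^sub>0) Ln" for k
  proof (cases k)
    case 0
    then show ?thesis by (auto intro!: continuous_intros)
  next
    case (Suc l)
    show ?thesis
      unfolding Suc
    proof (rule C_k_on_SucI[OF op])
      show "(Ln has_derivative (\<lambda>v. v * inverse z ^ 1)) (at z)" if "z \<in> - \<real>\<^sub>\<le>\<^sub>0" for z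
        using has_field_derivative_Ln[of z] that by (simp add: has_field_derivative_def mult_commute_abs)
      show "C_k_on l (- \<real>\<^sub>\<le>\<^sub>0) (\<lambda>z. v * inverse z ^ 1)" for v :: complex
        by (rule C_k_on_mono[OF C_k_on_inverse_complex]) auto
    qed
  qed
qed

section \<open>The torus action and the quotient\<close>

lemma has_vector_derivative_vec_lambda:
  fixes f :: "'n::finite \<Rightarrow> real \<Rightarrow> 'a::real_normed_vector"
  assumes "\<And>i. (f i has_vector_derivative f' i) F"
  shows "((\<lambda>s. \<chi> i. f i s) has_vector_derivative (\<chi> i. f' i)) F"
proof -
  have eq: "(\<chi> i. g i) = (\<Sum>i\<in>UNIV. axis i (g i))" for g :: "'n \<Rightarrow> 'a"
    by (simp add: vec_eq_iff axis_def)
  show ?thesis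
    unfolding eq
    by (intro has_vector_derivative_sum bounded_linear.has_vector_derivative[OF bounded_linear_axis] assms)
qed

lemma has_vector_derivative_eventually_cong:
  assumes "(f has_vector_derivative f') (at x)" "\<forall>\<^sub>F y in nhds x. f y = g y"
  shows "(g has_vector_derivative f') (at x)"
  using assms has_derivative_transform_eventually[of f _ x UNIV g]
  unfolding has_vector_derivative_def
  by (simp add: eventually_nhds_conv_at)

lemma cis_eq_cis_iff: "cis a = cis b \<longleftrightarrow> (\<exists>n::int. a = b + 2 * pi * of_int n)"
  using sin_cos_eq_iff[of a b] by (auto simp: complex_eq_iff)

lemma inner_vec_complex: "a \<bullet> b = (\<Sum>r\<in>UNIV. Re (cnj (a $ r) * b $ r))" for a b :: "complex^'d::finite"
  by (simp add: inner_vec_def inner_complex_def)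

lemma std_form_eq: "std_form a b = (\<Sum>r\<in>UNIV. Im (cnj (a $ r) * b $ r))"
  by (simp add: std_form_def algebra_simps)

lemma cnj_cis_mult_cis: "cnj (cis t * a) * (cis t * b) = cnj a * b"
proof -
  have "cnj (cis t) * cis t = 1" by (simp add: cis_cnj cis_mult)
  then have "(cnj (cis t) * cis t) * (cnj a * b) = cnj a * b" by simp
  then show ?thesis by (simp add: mult_ac)
qed

section \<open>The torus action and its generators\<close>

lemma torus_act_nth: "torus_act (torus_class s) z $ r = cis (s $ r) * z $ r"
  by (simp add: torus_act.abs_eq)

lemma torus_classE:
  obtains s where "t = torus_class s"
  by (induction t) blast

lemma torus_act_zero [simp]: "torus_act 0 z = z"
  by transfer (simp add: vec_eq_iff)

lemma torus_act_plus: "torus_act (s + t) z = torus_act s (torus_act t z)"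
  by transfer (simp add: vec_eq_iff cis_mult[symmetric] mult.assoc)

lemma torus_act_minus_cancel [simp]:
  "torus_act (- t) (torus_act t z) = z" "torus_act t (torus_act (- t) z) = z"
  by (simp_all add: torus_act_plus[symmetric])

lemma linear_torus_act: "linear (torus_act t)"
  by (rule linearI; transfer) (simp_all add: vec_eq_iff algebra_simps)

lemma bounded_linear_torus_act: "bounded_linear (torus_act t)"
  by (simp add: linear_torus_act linear_conv_bounded_linear[symmetric])

lemma norm_torus_act_nth [simp]: "norm (torus_act t z $ r) = norm (z $ r)"
  by transfer (simp add: norm_mult)

lemma torus_act_nth_eq_0_iff [simp]: "torus_act t z $ r = 0 \<longleftrightarrow> z $ r = 0"
  by (metis norm_eq_zero norm_torus_act_nth)

lemma inner_torus_act [simp]: "torus_act t a \<bullet> torus_act t b = a \<bullet> b"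
  unfolding inner_vec_complex by transfer (simp only: vec_lambda_beta cnj_cis_mult_cis)

lemma std_form_torus_act [simp]: "std_form (torus_act t a) (torus_act t b) = std_form a b"
  unfolding std_form_eq by transfer (simp only: vec_lambda_beta cnj_cis_mult_cis)

lemma std_J_torus_act: "std_J (torus_act t a) = torus_act t (std_J a)"
  unfolding std_J_def by transfer (simp add: vec_eq_iff)

text \<open>Freeness away from the coordinate hyperplanes. It makes the descriptions of
  \<open>omega_P\<close>, \<open>J_P\<close> and \<open>lin_comb\<close> unambiguous: the two base
  points of two lifts determine the torus element between them.\<close>

lemma torus_act_inj:
  assumes "\<And>r. z $ r \<noteq> 0" "torus_act s z = torus_act t z"
  shows "s = t"
  using assms
proof (induction s, induction t)
  fix a b :: "real^'a"
  assume "\<And>r. z $ r \<noteq> 0" and "torus_act (torus_class b) z = torus_act (torus_class a) z"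
  then have "cis (b $ r) = cis (a $ r)" for r
    by (metis mult_right_cancel torus_act_nth)
  then show "torus_class b = torus_class a"
    unfolding torus.abs_eq_iff period_lattice_def by (auto simp: cis_eq_cis_iff algebra_simps)
qed

lemma generator_has_vector_derivative:
  "((\<lambda>s. torus_act (torus_class (s *\<^sub>R \<xi>)) z) has_vector_derivative
    (\<chi> r. \<i> * of_real (\<xi> $ r) * z $ r)) (at 0)"
  unfolding torus_act.abs_eq
proof (rule has_vector_derivative_vec_lambda)
  fix r
  have "((\<lambda>w. exp (\<i> * (w * \<xi> $ r)) * z $ r) has_field_derivative \<i> * of_real (\<xi> $ r) * z $ r) (at (of_real 0))"
    by (auto intro!: derivative_eq_intros)
  from has_vector_derivative_real_field[OF this]
  show "((\<lambda>s. cis ((s *\<^sub>R \<xi>) $ r) * z $ r) has_vector_derivative \<i> * of_real (\<xi> $ r) * z $ r) (at 0)"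
    by (simp add: cis_conv_exp)
qed

lemma generator_eq: "generator \<xi> z = (\<chi> r. \<i> * of_real (\<xi> $ r) * z $ r)"
  unfolding generator_def by (rule vector_derivative_at[OF generator_has_vector_derivative])

lemma has_vector_derivative_torus_act:
  "((\<lambda>s. torus_act (torus_class (s *\<^sub>R \<xi>)) z) has_vector_derivative generator \<xi> z) (at 0)"
  unfolding generator_eq by (rule generator_has_vector_derivative)

lemma generator_torus_act: "generator \<xi> (torus_act t z) = torus_act t (generator \<xi> z)"
  unfolding generator_eq by transfer (simp add: vec_eq_iff)

lemma generator_add: "generator (\<xi> + \<eta>) z = generator \<xi> z + generator \<eta> z"
  by (simp add: generator_eq vec_eq_iff algebra_simps)

lemma generator_scaleR: "generator (c *\<^sub>R \<xi>) z = c *\<^sub>R generator \<xi> z"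
  by (simp add: generator_eq vec_eq_iff scaleR_conv_of_real[where 'a = complex] mult_ac)

lemma generator_0 [simp]: "generator 0 z = 0"
  by (simp add: generator_eq vec_eq_iff)

lemma generator_sum: "finite I \<Longrightarrow> generator (\<Sum>i\<in>I. \<xi> i) z = (\<Sum>i\<in>I. generator (\<xi> i) z)"
  by (induction I rule: finite_induct) (simp_all add: generator_add)

section \<open>The homomorphism of tori, its kernel and the orbits\<close>

lemma linear_beta: "linear (beta D)"
  by (rule linearI) (simp_all add: beta_def scaleR_left_distrib sum.distrib scaleR_sum_right)

lemma bounded_linear_beta: "bounded_linear (beta D)"
  using linear_beta linear_conv_bounded_linear by blast

lemma Lie_K_add: "\<xi> \<in> Lie_K D \<Longrightarrow> \<eta> \<in> Lie_K D \<Longrightarrow> \<xi> + \<eta> \<in> Lie_K D"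
  by (simp add: Lie_K_def linear_add[OF linear_beta])

lemma Lie_K_diff: "\<xi> \<in> Lie_K D \<Longrightarrow> \<eta> \<in> Lie_K D \<Longrightarrow> \<xi> - \<eta> \<in> Lie_K D"
  by (simp add: Lie_K_def linear_diff[OF linear_beta])

lemma Lie_K_0 [simp]: "0 \<in> Lie_K D"
  by (simp add: Lie_K_def linear_0[OF linear_beta])

lemma Lie_K_sum_scaleR:
  "(\<And>i. \<xi> i \<in> Lie_K D) \<Longrightarrow> (\<Sum>i\<in>I. c i *\<^sub>R \<xi> i) \<in> Lie_K D"
  by (simp add: Lie_K_def linear_sum[OF linear_beta] linear_scale[OF linear_beta])

lemma torus_hom_add: "torus_hom D (s + t) = torus_hom D s + torus_hom D t"
  by transfer (simp add: linear_add[OF linear_beta] period_lattice_0)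

lemma torus_hom_diff: "torus_hom D (s - t) = torus_hom D s - torus_hom D t"
  by transfer (simp add: linear_diff[OF linear_beta] period_lattice_0)

lemma K_0 [simp]: "0 \<in> K D"
  using torus_hom_diff[of D 0 0] by (simp add: K_def)

lemma K_add: "s \<in> K D \<Longrightarrow> t \<in> K D \<Longrightarrow> s + t \<in> K D"
  by (simp add: K_def torus_hom_add)

lemma K_diff: "s \<in> K D \<Longrightarrow> t \<in> K D \<Longrightarrow> s - t \<in> K D"
  by (simp add: K_def torus_hom_diff)

lemma torus_class_in_K_iff: "torus_class u \<in> K D \<longleftrightarrow> beta D u \<in> period_lattice"
  by (simp add: K_def torus_hom.abs_eq zero_torus_def torus.abs_eq_iff)

lemma proj_eq_iff: "proj D z = proj D w \<longleftrightarrow> (\<exists>t\<in>K D. w = torus_act t z)"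
proof
  assume "proj D z = proj D w"
  moreover have "w \<in> proj D w" unfolding proj_def by (auto intro!: exI[of _ 0])
  ultimately show "\<exists>t\<in>K D. w = torus_act t z" unfolding proj_def by auto
next
  assume "\<exists>t\<in>K D. w = torus_act t z"
  then obtain t where t: "t \<in> K D" "w = torus_act t z" by blast
  have "torus_act s z = torus_act (s - t) w" for s
    by (simp add: t(2) torus_act_plus[symmetric])
  then show "proj D z = proj D w"
  proof (intro subset_antisym subsetI)
    fix x assume "x \<in> proj D z"
    then show "x \<in> proj D w"
      unfolding proj_def using \<open>\<And>s. torus_act s z = torus_act (s - t) w\<close> K_diff[OF _ t(1)] by blast
  next
    fix x assume "x \<in> proj D w"
    then show "x \<in> proj D z"
      unfolding proj_def t(2) torus_act_plus[symmetric] using K_add[OF _ t(1)] by blast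
  qed
qed

lemma phi_T_torus_act [simp]: "phi_T D (torus_act t z) = phi_T D z"
  by (simp add: phi_T_def)

lemma torus_act_in_Z_iff [simp]: "torus_act t z \<in> Z D \<longleftrightarrow> z \<in> Z D"
  by (simp add: Z_def phi_K_def)

section \<open>Tangent vectors of the level set and of the quotient\<close>

lemma tangent_Z_iff:
  "v \<in> tangent_Z D z \<longleftrightarrow> (\<forall>\<xi>\<in>Lie_K D. (\<Sum>r\<in>UNIV. \<xi> $ r * (z $ r \<bullet> v $ r)) = 0)"
proof -
  have *: "((\<lambda>y. phi_K D y \<xi>) has_derivative (\<lambda>v. \<Sum>r\<in>UNIV. \<xi> $ r * (z $ r \<bullet> v $ r))) (at z)"
    if "\<xi> \<in> Lie_K D" for \<xi>
  proof -
    have eq: "(\<lambda>y. phi_K D y \<xi>) = (\<lambda>y. \<Sum>r\<in>UNIV. ((y $ r \<bullet> y $ r) / 2 + facet_offset D r) * \<xi> $ r)"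
      using that by (simp add: fun_eq_iff phi_K_def phi_T_def inner_vec_def power2_norm_eq_inner)
    have nth: "((\<lambda>y. y $ r) has_derivative (\<lambda>v. v $ r)) (at z)" for r
      by (rule bounded_linear_imp_has_derivative[OF bounded_linear_vec_nth])
    show ?thesis
      unfolding eq
      by (auto intro!: derivative_eq_intros nth sum.cong simp: inner_commute algebra_simps)
  qed
  show ?thesis
    unfolding tangent_Z_def by (simp add: frechet_derivative_at[OF *, symmetric])
qed

text \<open>The moment map identity with its sign convention: the sum is the derivative of the
  \<xi>-component of \<open>phi_T\<close> in the direction \<open>v\<close>.\<close>

lemma std_form_generator: "std_form (generator \<xi> z) v = - (\<Sum>r\<in>UNIV. \<xi> $ r * (z $ r \<bullet> v $ r))"
  by (simp add: std_form_def generator_eq inner_complex_def sum_negf[symmetric] algebra_simps)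

lemma std_form_generator_tangent:
  "v \<in> tangent_Z D z \<Longrightarrow> \<xi> \<in> Lie_K D \<Longrightarrow> std_form (generator \<xi> z) v = 0"
  by (simp add: std_form_generator tangent_Z_iff)

lemma std_form_commute: "std_form a b = - std_form b a"
  by (simp add: std_form_def sum_negf[symmetric] algebra_simps)

lemma std_form_add_left: "std_form (a + b) c = std_form a c + std_form b c"
  by (simp add: std_form_def sum.distrib[symmetric] algebra_simps)

lemma std_form_add_right: "std_form a (b + c) = std_form a b + std_form a c"
  by (simp add: std_form_def sum.distrib[symmetric] algebra_simps)

lemma torus_act_inner_nth: "torus_act t a $ r \<bullet> torus_act t b $ r = a $ r \<bullet> b $ r"
proof -
  have "x \<bullet> y = Re (cnj x * y)" for x y by (simp add: inner_complex_def)
  then show ?thesis by transfer (simp only: vec_lambda_beta cnj_cis_mult_cis)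
qed

lemma torus_act_tangent_Z: "torus_act t v \<in> tangent_Z D (torus_act t z) \<longleftrightarrow> v \<in> tangent_Z D z"
  by (simp add: tangent_Z_iff torus_act_inner_nth)

lemma generator_tangent_Z: "generator \<xi> z \<in> tangent_Z D z"
  by (simp add: tangent_Z_iff generator_eq inner_complex_def)

lemma horizontal_iff:
  "v \<in> horizontal D z \<longleftrightarrow> v \<in> tangent_Z D z \<and> (\<forall>\<xi>\<in>Lie_K D. v \<bullet> generator \<xi> z = 0)"
  by (simp add: horizontal_def)

lemma torus_act_horizontal: "v \<in> horizontal D z \<Longrightarrow> torus_act t v \<in> horizontal D (torus_act t z)"
  by (simp add: horizontal_iff torus_act_tangent_Z generator_torus_act)

text \<open>The pairs \<open>(t, \<xi>)\<close> form the tangent group of \<open>K\<close>, because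
  generators commute with the commutative torus action. So \<open>dproj\<close> produces orbits, and
  two orbits agree as soon as they share a point.\<close>

lemma dproj_eq_iff:
  "dproj D z a = dproj D w b \<longleftrightarrow>
     (\<exists>t\<in>K D. \<exists>\<xi>\<in>Lie_K D. w = torus_act t z \<and> b = torus_act t a + generator \<xi> w)"
proof
  assume "dproj D z a = dproj D w b"
  moreover have "(w, b) \<in> dproj D w b"
    unfolding dproj_def mem_Collect_eq by (rule exI[of _ 0], rule exI[of _ 0]) simp
  ultimately have "(w, b) \<in> dproj D z a" by simp
  then show "\<exists>t\<in>K D. \<exists>\<xi>\<in>Lie_K D. w = torus_act t z \<and> b = torus_act t a + generator \<xi> w"
    unfolding dproj_def by blast
next
  assume "\<exists>t\<in>K D. \<exists>\<xi>\<in>Lie_K D. w = torus_act t z \<and> b = torus_act t a + generator \<xi> w"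
  then obtain t \<xi> where t: "t \<in> K D" "\<xi> \<in> Lie_K D" "w = torus_act t z" "b = torus_act t a + generator \<xi> w"
    by blast
  have 1: "torus_act s w = torus_act (s + t) z"
    "torus_act s b + generator \<eta> (torus_act s w) =
      torus_act (s + t) a + generator (\<xi> + \<eta>) (torus_act (s + t) z)" for s \<eta>
    by (simp_all add: t(3,4) torus_act_plus linear_add[OF linear_torus_act] generator_torus_act generator_add)
  have 2: "torus_act s z = torus_act (s - t) w"
    "torus_act s a + generator \<eta> (torus_act s z) =
      torus_act (s - t) b + generator (\<eta> - \<xi>) (torus_act (s - t) w)" for s \<eta>
    using 1(1)[of "s - t"] 1(2)[of "s - t" "\<eta> - \<xi>"] by simp_all
  show "dproj D z a = dproj D w b"
  proof (intro subset_antisym subsetI)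
    fix x assume "x \<in> dproj D z a"
    then obtain s \<eta> where "s \<in> K D" "\<eta> \<in> Lie_K D" "x = (torus_act s z, torus_act s a + generator \<eta> (torus_act s z))"
      unfolding dproj_def by blast
    then show "x \<in> dproj D w b"
      using K_diff[OF _ t(1), of s] Lie_K_diff[OF _ t(2), of \<eta>] 2[of s] unfolding dproj_def
      by auto
  next
    fix x assume "x \<in> dproj D w b"
    then obtain s \<eta> where "s \<in> K D" "\<eta> \<in> Lie_K D" "x = (torus_act s w, torus_act s b + generator \<eta> (torus_act s w))"
      unfolding dproj_def by blast
    then show "x \<in> dproj D z a"
      using K_add[OF _ t(1), of s] Lie_K_add[OF t(2), of \<eta>] 1[of s] unfolding dproj_def
      by auto
  qed
qed

text \<open>By freeness the lifts of both arguments are moved by the same torus element, which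
  preserves \<open>std_form\<close>. The generators that are added pair to zero with tangent vectors
  of the level set.\<close>

lemma omega_P_dproj:
  assumes z: "z \<in> Z D" "\<And>r. z $ r \<noteq> 0" and ab: "a \<in> tangent_Z D z" "b \<in> tangent_Z D z"
  shows "omega_P D (dproj D z a) (dproj D z b) = std_form a b"
  unfolding omega_P_def
proof (rule the_equality)
  fix c
  assume "\<exists>w\<in>Z D. \<exists>a'\<in>tangent_Z D w. \<exists>b'\<in>tangent_Z D w.
    dproj D z a = dproj D w a' \<and> dproj D z b = dproj D w b' \<and> c = std_form a' b'"
  then obtain w a' b' where *: "dproj D z a = dproj D w a'" "dproj D z b = dproj D w b'" "c = std_form a' b'"
    "a' \<in> tangent_Z D w" "b' \<in> tangent_Z D w"
    by blast
  from *(1) obtain t \<xi> where t: "\<xi> \<in> Lie_K D" "w = torus_act t z" "a' = torus_act t a + generator \<xi> w"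
    unfolding dproj_eq_iff by blast
  from *(2) obtain s \<eta> where s: "\<eta> \<in> Lie_K D" "w = torus_act s z" "b' = torus_act s b + generator \<eta> w"
    unfolding dproj_eq_iff by blast
  have "s = t" using torus_act_inj[OF z(2)] t(2) s(2) by metis
  then have b': "b' = torus_act t b + generator \<eta> w" using s(3) by simp
  have tan: "torus_act t a \<in> tangent_Z D w" unfolding t(2) using ab by (simp add: torus_act_tangent_Z)
  have "c = std_form (torus_act t a) b' + std_form (generator \<xi> w) b'"
    by (simp add: *(3) t(3) std_form_add_left)
  also have "std_form (generator \<xi> w) b' = 0"
    by (rule std_form_generator_tangent[OF *(5) t(1)])
  also have "std_form (torus_act t a) b' = std_form a b + std_form (torus_act t a) (generator \<eta> w)"
    by (simp add: b' std_form_add_right)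
  also have "std_form (torus_act t a) (generator \<eta> w) = 0"
    using std_form_generator_tangent[OF tan s(1)] std_form_commute[of "torus_act t a"] by simp
  finally show "c = std_form a b" by simp
qed (use assms in blast)

text \<open>A horizontal lift is unique up to \<open>K\<close>, and the action of \<open>K\<close>
  commutes with \<open>std_J\<close>.\<close>

lemma J_P_dproj:
  assumes z: "z \<in> Z D" "\<And>r. z $ r \<noteq> 0" and a: "a \<in> horizontal D z"
  shows "J_P D (dproj D z a) = dproj D z (std_J a)"
  unfolding J_P_def
proof (rule the_equality)
  fix B
  assume "\<exists>w\<in>Z D. \<exists>b\<in>horizontal D w. dproj D z a = dproj D w b \<and> B = dproj D w (std_J b)"
  then obtain w b where b: "b \<in> horizontal D w" "dproj D z a = dproj D w b" "B = dproj D w (std_J b)"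
    by blast
  from b(2) obtain t \<xi> where t: "t \<in> K D" "\<xi> \<in> Lie_K D" "w = torus_act t z" "b = torus_act t a + generator \<xi> w"
    unfolding dproj_eq_iff by blast
  \<comment> \<open>The difference of the two horizontal lifts is a generator of
    \<open>Lie_K D\<close>, hence orthogonal to itself.\<close>
  have "torus_act t a \<bullet> generator \<xi> w = 0" "b \<bullet> generator \<xi> w = 0"
    using torus_act_horizontal[OF a, of t] b(1) t(2,3) by (simp_all add: horizontal_iff)
  then have "generator \<xi> w \<bullet> generator \<xi> w = 0" by (simp add: t(4) inner_add_left)
  then have "std_J b = torus_act t (std_J a)" by (simp add: t(4) std_J_torus_act)
  then show "B = dproj D z (std_J a)"
    using t(1,3) unfolding b(3) by (metis Lie_K_0 add.right_neutral dproj_eq_iff generator_0)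
qed (use assms in blast)

text \<open>Each vector of the family could be lifted with its own element of \<open>K\<close>;
  freeness forces all these elements to agree, so that the ambiguity is linear in the
  family.\<close>

lemma lin_comb_dproj:
  assumes z: "z \<in> Z D" "\<And>r. z $ r \<noteq> 0" and a: "\<And>i. a i \<in> tangent_Z D z"
  shows "lin_comb D c (\<lambda>i. dproj D z (a i)) = dproj D z (\<Sum>i\<in>UNIV. c i *\<^sub>R a i)"
  unfolding lin_comb_def
proof (rule the_equality)
  fix A
  assume "\<exists>w\<in>Z D. \<exists>b. (\<forall>i. b i \<in> tangent_Z D w \<and> dproj D z (a i) = dproj D w (b i)) \<and>
    A = dproj D w (\<Sum>i\<in>UNIV. c i *\<^sub>R b i)"
  then obtain w b where b: "\<And>i. dproj D z (a i) = dproj D w (b i)" "A = dproj D w (\<Sum>i\<in>UNIV. c i *\<^sub>R b i)"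
    by blast
  have "\<exists>t \<xi>. t \<in> K D \<and> \<xi> \<in> Lie_K D \<and> w = torus_act t z \<and> b i = torus_act t (a i) + generator \<xi> w" for i
    using b(1)[of i] unfolding dproj_eq_iff by blast
  then obtain t \<xi> where t: "\<And>i. t i \<in> K D" "\<And>i. \<xi> i \<in> Lie_K D" "\<And>i. w = torus_act (t i) z"
    "\<And>i. b i = torus_act (t i) (a i) + generator (\<xi> i) w"
    by metis
  obtain u where u: "u \<in> K D" "w = torus_act u z" using t(1,3) by blast
  have tu: "t i = u" for i using torus_act_inj[OF z(2)] t(3) u(2) by metis
  have "(\<Sum>i\<in>UNIV. c i *\<^sub>R b i) = torus_act u (\<Sum>i\<in>UNIV. c i *\<^sub>R a i) + generator (\<Sum>i\<in>UNIV. c i *\<^sub>R \<xi> i) w"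
    by (simp add: t(4) tu scaleR_add_right sum.distrib linear_sum[OF linear_torus_act]
        linear_scale[OF linear_torus_act] generator_sum generator_scaleR)
  moreover have "(\<Sum>i\<in>UNIV. c i *\<^sub>R \<xi> i) \<in> Lie_K D" by (rule Lie_K_sum_scaleR[OF t(2)])
  ultimately have "dproj D z (\<Sum>i\<in>UNIV. c i *\<^sub>R a i) = A"
    unfolding b(2) dproj_eq_iff using u by blast
  then show "A = dproj D z (\<Sum>i\<in>UNIV. c i *\<^sub>R a i)" ..
qed (intro bexI[OF _ z(1)] exI[of _ a] conjI allI a refl)

text \<open>Two lifts of a curve differ by a curve in the preimage of \<open>K\<close> in \<open>\<real>\<^sup>d\<close>. Normalized to start at
  \<open>0\<close>, its image under \<open>beta\<close> is a continuous curve in a lattice, so its velocity lies in \<open>Lie_K\<close>.\<close>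

lemma dproj_lift_unique:
  assumes g: "\<forall>\<^sub>F t in nhds 0. proj D (\<gamma> t) = c t" "(\<gamma> has_vector_derivative v) (at 0)"
    and g': "\<forall>\<^sub>F t in nhds 0. proj D (\<gamma>' t) = c t" "(\<gamma>' has_vector_derivative v') (at 0)"
    and reg: "\<And>r. \<gamma> 0 $ r \<noteq> 0"
  shows "dproj D (\<gamma> 0) v = dproj D (\<gamma>' 0) v'"
proof -
  have same: "\<forall>\<^sub>F t in nhds 0. proj D (\<gamma> t) = proj D (\<gamma>' t)"
    using g(1) g'(1) by eventually_elim simp
  then obtain k where k: "k \<in> K D" "\<gamma>' 0 = torus_act k (\<gamma> 0)"
    using eventually_nhds_x_imp_x unfolding proj_eq_iff by blast
  \<comment> \<open>The second lift, moved by an element of \<open>K\<close> so that both lifts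
    start at \<open>\<gamma> 0\<close>.\<close>
  define \<delta> where "\<delta> = (\<lambda>t. torus_act (- k) (\<gamma>' t))"
  define w where "w = torus_act (- k) v'"
  have \<delta>: "(\<delta> has_vector_derivative w) (at 0)"
    unfolding \<delta>_def w_def by (rule bounded_linear.has_vector_derivative[OF bounded_linear_torus_act g'(2)])
  have \<delta>0: "\<delta> 0 = \<gamma> 0" by (simp add: \<delta>_def k(2))
  \<comment> \<open>The ratio of the lifts is 1 at time 0, where the principal \<open>Ln\<close> is
    differentiable. Its imaginary part is a choice of the angles between the lifts that is
    differentiable at 0.\<close>
  define \<Lambda> where "\<Lambda> = (\<lambda>r t. Ln (\<delta> t $ r / \<gamma> t $ r))"
  define q where "q = (\<lambda>r. (w $ r - v $ r) / \<gamma> 0 $ r)"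
  have \<Lambda>: "(\<Lambda> r has_vector_derivative q r) (at 0)" for r
  proof -
    have "((\<lambda>t. \<delta> t $ r) has_vector_derivative w $ r) (at 0)" "((\<lambda>t. \<gamma> t $ r) has_vector_derivative v $ r) (at 0)"
      using \<delta> g(2) by (auto intro: bounded_linear.has_vector_derivative[OF bounded_linear_vec_nth])
    then have "((\<lambda>t. \<delta> t $ r / \<gamma> t $ r) has_vector_derivative q r) (at 0)"
      using reg[of r] unfolding has_vector_derivative_def
      by (auto intro!: derivative_eq_intros simp: \<delta>0 q_def fun_eq_iff field_simps scaleR_conv_of_real)
    then have "(Ln \<circ> (\<lambda>t. \<delta> t $ r / \<gamma> t $ r) has_vector_derivative (q r * inverse (\<delta> 0 $ r / \<gamma> 0 $ r))) (at 0)"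
      by (rule field_vector_diff_chain_at) (use reg[of r] has_field_derivative_Ln[of 1] in \<open>simp add: \<delta>0\<close>)
    then show ?thesis using reg[of r] by (simp add: \<Lambda>_def o_def \<delta>0)
  qed
  have "\<gamma> \<midarrow>0\<rightarrow> \<gamma> 0"
    using g(2) has_vector_derivative_continuous isCont_def by blast
  then have "\<forall>\<^sub>F t in nhds 0. \<gamma> t $ r \<noteq> 0" for r
    using tendsto_imp_eventually_ne[OF tendsto_vec_nth reg[of r]] reg[of r]
    by (simp add: eventually_nhds_conv_at)
  then have "\<forall>\<^sub>F t in nhds 0. \<forall>r. \<gamma> t $ r \<noteq> 0"
    by (simp add: eventually_all_finite)
  with same have lift: "\<forall>\<^sub>F t in nhds 0. (\<forall>r. Re (\<Lambda> r t) = 0) \<and> beta D (\<chi> r. Im (\<Lambda> r t)) \<in> period_lattice"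
  proof eventually_elim
    case (elim t)
    then obtain s where s: "s \<in> K D" "\<gamma>' t = torus_act s (\<gamma> t)"
      unfolding proj_eq_iff by blast
    obtain u where u: "s - k = torus_class u" by (rule torus_classE)
    have "\<delta> t = torus_act (torus_class u) (\<gamma> t)"
      by (simp add: \<delta>_def s(2) u[symmetric] torus_act_plus[symmetric])
    then have ratio: "\<delta> t $ r / \<gamma> t $ r = cis (u $ r)" for r
      using elim(2) by (simp add: torus_act_nth)
    have \<Lambda>t: "\<Lambda> r t = \<i> * Im (\<Lambda> r t)" "cis (Im (\<Lambda> r t)) = cis (u $ r)" for r
    proof -
      have "Re (\<Lambda> r t) = 0" by (simp add: \<Lambda>_def ratio)
      then show *: "\<Lambda> r t = \<i> * Im (\<Lambda> r t)" by (simp add: complex_eq_iff)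
      have "exp (\<Lambda> r t) = cis (u $ r)" by (simp add: \<Lambda>_def ratio)
      with * show "cis (Im (\<Lambda> r t)) = cis (u $ r)" by (simp add: cis_conv_exp)
    qed
    have "(\<chi> r. Im (\<Lambda> r t)) - u \<in> period_lattice"
      using \<Lambda>t(2) unfolding period_lattice_def cis_eq_cis_iff by (simp add: algebra_simps)
    then have "beta D ((\<chi> r. Im (\<Lambda> r t)) - u) \<in> period_lattice" by (rule beta_period_lattice)
    moreover have "beta D u \<in> period_lattice"
      using K_diff[OF s(1) k(1)] unfolding u torus_class_in_K_iff .
    ultimately have "beta D ((\<chi> r. Im (\<Lambda> r t)) - u) + beta D u \<in> period_lattice"
      by (rule period_lattice_add)
    moreover have "Re (\<Lambda> r t) = 0" for r by (simp add: \<Lambda>_def ratio)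
    ultimately show ?case by (simp add: beta_diff)
  qed
  \<comment> \<open>The ratios have modulus 1 near time 0, so their logarithms are imaginary
    there.\<close>
  have Req: "Re (q r) = 0" for r
  proof -
    have "((\<lambda>t. Re (\<Lambda> r t)) has_vector_derivative Re (q r)) (at 0)"
      by (rule bounded_linear.has_vector_derivative[OF bounded_linear_Re \<Lambda>])
    moreover have "\<forall>\<^sub>F t in nhds 0. Re (\<Lambda> r t) = 0" using lift by eventually_elim simp
    ultimately have "((\<lambda>t. 0) has_vector_derivative Re (q r)) (at (0::real))"
      by (rule has_vector_derivative_eventually_cong)
    then show ?thesis using vector_derivative_unique_at has_vector_derivative_const by metis
  qed
  define \<xi> where "\<xi> = (\<chi> r. Im (q r))"
  have "((\<lambda>t. \<chi> r. Im (\<Lambda> r t)) has_vector_derivative \<xi>) (at 0)"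
    unfolding \<xi>_def
    by (rule has_vector_derivative_vec_lambda, rule bounded_linear.has_vector_derivative[OF bounded_linear_Im \<Lambda>])
  then have b': "((\<lambda>t. beta D (\<chi> r. Im (\<Lambda> r t))) has_vector_derivative beta D \<xi>) (at 0)"
    by (rule bounded_linear.has_vector_derivative[OF bounded_linear_beta])
  have \<Lambda>0: "\<Lambda> r 0 = 0" for r using reg[of r] by (simp add: \<Lambda>_def \<delta>0)
  have "((\<lambda>t. beta D (\<chi> r. Im (\<Lambda> r t))) \<longlongrightarrow> 0) (at 0)"
    using has_vector_derivative_continuous[OF b']
    by (simp add: isCont_def \<Lambda>0 zero_vec_def[symmetric] linear_0[OF linear_beta])
  \<comment> \<open>A nonzero element of \<open>period_lattice\<close> has a component of absolute
    value at least \<open>2 * pi\<close>; below this bound only 0 is left.\<close>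
  then have "\<forall>\<^sub>F t in at 0. norm (beta D (\<chi> r. Im (\<Lambda> r t))) < 2 * pi"
    by (intro order_tendstoD(2)[OF tendsto_norm_zero]) auto
  then have "\<forall>\<^sub>F t in nhds 0. norm (beta D (\<chi> r. Im (\<Lambda> r t))) < 2 * pi"
    by (simp add: eventually_nhds_conv_at \<Lambda>0 zero_vec_def[symmetric] linear_0[OF linear_beta])
  with lift have "\<forall>\<^sub>F t in nhds 0. beta D (\<chi> r. Im (\<Lambda> r t)) = 0"
  proof eventually_elim
    case (elim t)
    have "beta D (\<chi> r. Im (\<Lambda> r t)) $ i = 0" for i
    proof -
      obtain m :: int where m: "beta D (\<chi> r. Im (\<Lambda> r t)) $ i = 2 * pi * m"
        using elim(1) unfolding period_lattice_def by blast
      have "\<bar>2 * pi * m\<bar> < 2 * pi"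
        using component_le_norm_cart[of "beta D (\<chi> r. Im (\<Lambda> r t))" i] elim(2) unfolding m by simp
      then have "\<bar>real_of_int m\<bar> < 1" by (simp add: abs_mult)
      then have "m = 0" by linarith
      then show ?thesis by (simp add: m)
    qed
    then show ?case by (simp add: vec_eq_iff)
  qed
  from has_vector_derivative_eventually_cong[OF b' this] have "beta D \<xi> = 0"
    using vector_derivative_unique_at has_vector_derivative_const by metis
  then have \<xi>: "\<xi> \<in> Lie_K D" by (simp add: Lie_K_def)
  have "w = v + generator \<xi> (\<gamma> 0)"
  proof -
    have "w $ r = v $ r + \<i> * of_real (\<xi> $ r) * \<gamma> 0 $ r" for r
    proof -
      have "w $ r - v $ r = q r * \<gamma> 0 $ r" using reg[of r] by (simp add: q_def)
      also have "q r = \<i> * of_real (\<xi> $ r)" using Req[of r] by (simp add: \<xi>_def complex_eq_iff)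
      finally show ?thesis by (simp add: algebra_simps)
    qed
    then show ?thesis by (simp add: vec_eq_iff generator_eq)
  qed
  then have "torus_act k w = torus_act k v + generator \<xi> (\<gamma>' 0)"
    by (simp add: linear_add[OF linear_torus_act] k(2) generator_torus_act)
  then have "v' = torus_act k v + generator \<xi> (\<gamma>' 0)" by (simp add: w_def)
  with k \<xi> show ?thesis unfolding dproj_eq_iff by blast
qed

lemma velocity_eq:
  assumes "\<forall>\<^sub>F t in nhds 0. \<gamma> t \<in> Z D \<and> proj D (\<gamma> t) = c t" "(\<gamma> has_vector_derivative v) (at 0)"
    and "\<And>r. \<gamma> 0 $ r \<noteq> 0"
  shows "velocity D c = dproj D (\<gamma> 0) v"
  unfolding velocity_def
proof (rule the_equality)
  fix A
  assume "\<exists>\<gamma> v. (\<forall>\<^sub>F t in nhds 0. \<gamma> t \<in> Z D \<and> proj D (\<gamma> t) = c t) \<and>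
     (\<gamma> has_vector_derivative v) (at 0) \<and> A = dproj D (\<gamma> 0) v"
  then obtain \<gamma>' v' where "\<forall>\<^sub>F t in nhds 0. \<gamma>' t \<in> Z D \<and> proj D (\<gamma>' t) = c t"
     "(\<gamma>' has_vector_derivative v') (at 0)" "A = dproj D (\<gamma>' 0) v'"
    by blast
  with assms show "A = dproj D (\<gamma> 0) v"
    using dproj_lift_unique[of D \<gamma> c v \<gamma>' v'] by (simp add: eventually_conj_iff)
qed (use assms in blast)

lemma std_J_std_J: "std_J (std_J a) = - a"
  by (simp add: std_J_def vec_eq_iff)

lemma linear_std_J: "linear std_J"
  by (rule linearI) (simp_all add: std_J_def vec_eq_iff algebra_simps)

lemma Lie_K_sum: "\<xi> \<in> Lie_K D \<Longrightarrow> (\<Sum>r\<in>UNIV. \<xi> $ r * conormal D r $ j) = 0"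
  by (auto simp: Lie_K_def beta_def vec_eq_iff)

lemma horizontal_sum:
  assumes "\<And>i. i \<in> I \<Longrightarrow> v i \<in> horizontal D z"
  shows "(\<Sum>i\<in>I. c i *\<^sub>R v i) \<in> horizontal D z"
proof -
  have "(\<Sum>r\<in>UNIV. \<xi> $ r * (z $ r \<bullet> (\<Sum>i\<in>I. c i *\<^sub>R v i) $ r)) = 0" if \<xi>: "\<xi> \<in> Lie_K D" for \<xi>
  proof -
    have "(\<Sum>r\<in>UNIV. \<xi> $ r * (z $ r \<bullet> (\<Sum>i\<in>I. c i *\<^sub>R v i) $ r)) =
        (\<Sum>i\<in>I. c i * (\<Sum>r\<in>UNIV. \<xi> $ r * (z $ r \<bullet> v i $ r)))"
      unfolding sum_distrib_left by (subst sum.swap) (simp add: inner_sum_right sum_distrib_left mult_ac)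
    then show ?thesis using assms \<xi> by (simp add: horizontal_iff tangent_Z_iff)
  qed
  moreover have "(\<Sum>i\<in>I. c i *\<^sub>R v i) \<bullet> generator \<xi> z = 0" if "\<xi> \<in> Lie_K D" for \<xi>
    using assms that by (simp add: inner_sum_left horizontal_iff)
  ultimately show ?thesis by (simp add: horizontal_iff tangent_Z_iff)
qed

section \<open>Topology of products with the torus\<close>

lemma continuous_on_torus_class: "continuous_on UNIV (torus_class :: real^'n::finite \<Rightarrow> 'n torus)"
  by (simp add: continuous_on_open_vimage open_torus_def)

lemma open_torus_class_image:
  assumes "open U"
  shows "open (torus_class ` U :: 'n::finite torus set)"
proof -
  have "torus_class -` (torus_class ` U) = (\<Union>l\<in>period_lattice. (\<lambda>s. l + s) ` U)"
  proof (intro subset_antisym subsetI)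
    fix s assume "s \<in> torus_class -` (torus_class ` U)"
    then obtain u where "u \<in> U" "s - u \<in> period_lattice" by (auto simp: torus.abs_eq_iff)
    then show "s \<in> (\<Union>l\<in>period_lattice. (\<lambda>s. l + s) ` U)" by (force intro: image_eqI[of _ _ u])
  next
    fix s assume "s \<in> (\<Union>l\<in>period_lattice. (\<lambda>s. l + s) ` U)"
    then obtain l u where "l \<in> period_lattice" "u \<in> U" "s = l + u" by blast
    then have "torus_class s = torus_class u" by (simp add: torus.abs_eq_iff)
    then show "s \<in> torus_class -` (torus_class ` U)" using \<open>u \<in> U\<close> by simp
  qed
  then show ?thesis
    unfolding open_torus_def using assms by (simp add: open_UN open_translation)
qed

text \<open>A product with a quotient space need not carry the quotient topology; here it does
  because \<open>torus_class\<close> is an open map. Openness in the coordinate domain can thus be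
  tested on the universal cover.\<close>

lemma open_prod_torus_iff:
  fixes U :: "('a::topological_space \<times> 'n::finite torus) set"
  shows "open U \<longleftrightarrow> open {(x, s). (x, torus_class s) \<in> U}"
proof
  assume "open U"
  moreover have "{(x, s). (x, torus_class s) \<in> U} = (\<lambda>p. (fst p, torus_class (snd p))) -` U" by auto
  moreover have "continuous_on UNIV (\<lambda>p::'a \<times> (real^'n). (fst p, torus_class (snd p)))"
    by (intro continuous_on_Pair continuous_on_fst continuous_on_compose2[OF continuous_on_torus_class]
        continuous_on_snd continuous_on_id) auto
  ultimately show "open {(x, s). (x, torus_class s) \<in> U}"
    by (simp add: open_vimage)
next
  assume *: "open {(x, s). (x, torus_class s) \<in> U}"
  show "open U"
  proof (rule open_prod_intro)
    fix p assume "p \<in> U"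
    moreover obtain x s where p: "p = (x, torus_class s)"
    proof -
      obtain s where "snd p = torus_class s" by (rule torus_classE)
      then show thesis using that[of "fst p" s] by (simp add: prod_eq_iff)
    qed
    ultimately have "(x, s) \<in> {(x, s). (x, torus_class s) \<in> U}" by simp
    with * obtain A B where "open A" "open B" "(x, s) \<in> A \<times> B" "A \<times> B \<subseteq> {(x, s). (x, torus_class s) \<in> U}"
      by (rule open_prod_elim)
    then show "\<exists>A B. open A \<and> open B \<and> p \<in> A \<times> B \<and> A \<times> B \<subseteq> U"
      using open_torus_class_image[of B] p
      by (intro exI[of _ A] exI[of _ "torus_class ` B"]) auto
  qed
qed

lemma smooth_on_vec_nth: "open U \<Longrightarrow> smooth_on U (\<lambda>x. x $ i)"
  by (rule smooth_on_bounded_linear[OF bounded_linear_vec_nth])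

lemma sum_UNIV_Plus:
  "(\<Sum>i\<in>(UNIV :: ('a::finite + 'b::finite) set). f i) = (\<Sum>a\<in>UNIV. f (Inl a)) + (\<Sum>b\<in>UNIV. f (Inr b))"
  by (subst UNIV_Plus_UNIV[symmetric], subst sum.Plus) (simp_all add: o_def)

section \<open>The moment map and its zero level\<close>

lemma adjoint_beta: "adjoint (beta D) = (\<lambda>x. \<chi> r. x \<bullet> conormal D r)"
  by (rule adjoint_unique)
     (simp add: beta_def inner_sum_left inner_vec_def[of _ "\<chi> r. _ r"] inner_commute inner_sum_right)

lemma ell_has_derivative [derivative_intros]:
  "((\<lambda>x. ell D r x) has_derivative (\<lambda>v. v \<bullet> conormal D r)) (at x within S)"
  unfolding ell_def by (auto intro!: derivative_eq_intros)

lemma phi_T_eq_ell_iff: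
  "phi_T D z = adjoint (beta D) x \<longleftrightarrow> (\<forall>r. (norm (z $ r))\<^sup>2 / 2 = ell D r x)"
  by (auto simp: phi_T_def adjoint_beta vec_eq_iff ell_def algebra_simps)

text \<open>Vanishing on \<open>Lie_K D\<close> means that \<open>phi_T D z\<close> is orthogonal to
  the kernel of \<open>beta D\<close>, hence lies in the range of the adjoint. A preimage under the
  adjoint is the required \<open>x\<close>.\<close>

lemma Z_iff: "z \<in> Z D \<longleftrightarrow> (\<exists>x. \<forall>r. (norm (z $ r))\<^sup>2 / 2 = ell D r x)"
proof -
  have "z \<in> Z D \<longleftrightarrow> phi_T D z \<in> orthogonal_comp (Lie_K D)"
    by (auto simp: Z_def phi_K_def orthogonal_comp_def orthogonal_def inner_commute)
  also have "Lie_K D = orthogonal_comp (range (adjoint (beta D)))"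
    using ker_orthogonal_comp_adjoint[OF linear_beta[of D]] by (auto simp: Lie_K_def vimage_def)
  also have "orthogonal_comp (orthogonal_comp (range (adjoint (beta D)))) = range (adjoint (beta D))"
    by (intro orthogonal_comp_self linear_subspace_image adjoint_linear linear_beta subspace_UNIV)
  finally show ?thesis unfolding phi_T_eq_ell_iff[symmetric] by auto
qed

lemma smooth_on_ell: "open U \<Longrightarrow> smooth_on U (ell D r)"
  unfolding ell_def[abs_def] diff_conv_add_uminus
  by (intro smooth_on_add smooth_on_const smooth_on_bounded_linear[OF bounded_linear_inner_left])

section \<open>The chart given by symplectic coordinates\<close>

locale toric =
  fixes P :: "(real^'n::finite) set" and D :: "('n, 'd::finite) facet_data"
  assumes labeled_polytope: "labeled_polytope P D"
begin

lemma conormal_ne_0: "conormal D r \<noteq> 0"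
proof
  assume "conormal D r = 0"
  moreover have "facet_label D r > 0" using labeled_polytope unfolding labeled_polytope_def by blast
  ultimately have "facet_normal D r $ j = 0" for j
    by (auto simp: conormal_def vec_eq_iff)
  then have "Gcd (range (\<lambda>j. facet_normal D r $ j)) = 0" by simp
  with labeled_polytope show False unfolding labeled_polytope_def by simp
qed

lemma P_eq: "P = {x. \<forall>r. 0 \<le> ell D r x}"
  using labeled_polytope unfolding labeled_polytope_def by auto

lemma interior_P_eq: "interior P = {x. \<forall>r. 0 < ell D r x}"
proof
  show "interior P \<subseteq> {x. \<forall>r. 0 < ell D r x}"
  proof safe
    fix x r assume "x \<in> interior P"
    moreover have "P \<subseteq> {x. facet_offset D r \<le> conormal D r \<bullet> x}"
      unfolding P_eq by (auto simp: ell_def inner_commute)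
    ultimately have "x \<in> interior {x. facet_offset D r \<le> conormal D r \<bullet> x}"
      using interior_mono by blast
    then show "0 < ell D r x"
      unfolding interior_halfspace_ge[OF conormal_ne_0] by (simp add: ell_def inner_commute)
  qed
  have "{x. \<forall>r. 0 < ell D r x} = (\<Inter>r. {x. facet_offset D r < conormal D r \<bullet> x})"
    by (auto simp: ell_def inner_commute)
  then have "open {x. \<forall>r. 0 < ell D r x}"
    by (simp add: open_INT open_halfspace_gt)
  then show "{x. \<forall>r. 0 < ell D r x} \<subseteq> interior P"
    by (rule interior_maximal[rotated]) (auto simp: P_eq less_imp_le)
qed

lemma ell_pos: "x \<in> interior P \<Longrightarrow> 0 < ell D r x"
  by (simp add: interior_P_eq)

text \<open>A nonzero \<open>x\<close> orthogonal to all conormals would span a line inside the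
  bounded set \<open>P\<close>. Both the surjectivity of \<open>beta D\<close> and the invertibility
  of the Hessian rest on this.\<close>

lemma conormal_separates:
  assumes x: "\<And>r. x \<bullet> conormal D r = 0"
  shows "x = 0"
proof (rule ccontr)
  assume "x \<noteq> 0"
  obtain p where "p \<in> P"
    using labeled_polytope interior_subset unfolding labeled_polytope_def by blast
  then have line: "p + t *\<^sub>R x \<in> P" for t
    by (simp add: P_eq ell_def inner_add_left x)
  obtain B where B: "\<And>y. y \<in> P \<Longrightarrow> norm y \<le> B"
  proof -
    have "bounded P" using labeled_polytope polytope_imp_bounded unfolding labeled_polytope_def by blast
    then show thesis using that unfolding bounded_iff by blast
  qed
  \<comment> \<open>Chosen so that \<open>t *\<^sub>R x\<close> has norm
    \<open>B + norm p + 1\<close>, more than the triangle inequality allows.\<close>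
  define t where "t = (B + norm p + 1) / norm x"
  have "0 \<le> B" using B[OF \<open>p \<in> P\<close>] norm_ge_zero order_trans by blast
  have "norm (t *\<^sub>R x) \<le> norm (p + t *\<^sub>R x) + norm p"
    using norm_triangle_ineq4[of "p + t *\<^sub>R x" p] by simp
  also have "\<dots> \<le> B + norm p" using B[OF line] by simp
  finally show False using \<open>x \<noteq> 0\<close> \<open>0 \<le> B\<close> by (simp add: t_def)
qed

lemma surj_beta: "surj (beta D)"
proof -
  have "inj (adjoint (beta D))"
  proof (rule linear_injective_0[OF adjoint_linear[OF linear_beta], THEN iffD2], intro allI impI)
    fix x assume "adjoint (beta D) x = 0"
    then show "x = 0" by (intro conormal_separates) (simp add: adjoint_beta vec_eq_iff)
  qed
  then show ?thesis
    using surj_adjoint_iff_inj[OF adjoint_linear[OF linear_beta[of D]]]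
    by (simp add: adjoint_adjoint[OF linear_beta])
qed

text \<open>Because of the labels a section need not preserve the period lattices, so in general it
  does not descend to the tori. It only serves to lift curves and angles on the universal
  cover.\<close>

definition section_beta :: "real^'n \<Rightarrow> real^'d" where
  "section_beta = (SOME g. linear g \<and> beta D \<circ> g = id)"

lemma section_beta: "linear section_beta" "beta D (section_beta s) = s"
  using someI_ex[OF linear_surjective_right_inverse[OF linear_beta surj_beta]]
  by (simp_all add: section_beta_def fun_eq_iff)

lemma surj_torus_hom:
  obtains t where "torus_hom D t = \<theta>"
proof -
  obtain s where "\<theta> = torus_class s" by (rule torus_classE)
  then have "torus_hom D (torus_class (section_beta s)) = \<theta>"
    by (simp add: torus_hom.abs_eq section_beta(2))
  then show ?thesis using that by blast
qed

text \<open>The adjoint of a right inverse of \<open>beta D\<close> is a left inverse of the adjoint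
  of \<open>beta D\<close>. This gives a formula for the moment map of the quotient that makes
  sense, and is smooth, off the level set too.\<close>

definition mu :: "complex^'d \<Rightarrow> real^'n" where
  "mu z = adjoint section_beta (phi_T D z)"

lemma mu_eqI: assumes "\<And>r. (norm (z $ r))\<^sup>2 / 2 = ell D r x" shows "mu z = x"
proof -
  have "adjoint section_beta (adjoint (beta D) x) \<bullet> y = x \<bullet> y" for y
    by (simp add: adjoint_works[OF section_beta(1)] adjoint_works[OF linear_beta] section_beta(2)
        inner_commute[of _ y] inner_commute[of x])
  then have "adjoint section_beta (adjoint (beta D) x) = x" by (metis vector_eq_rdot)
  then show ?thesis using assms phi_T_eq_ell_iff[of D z x] by (simp add: mu_def)
qed

lemma mu_torus_act [simp]: "mu (torus_act t z) = mu z"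
  by (simp add: mu_def)

lemma norm_Z: "z \<in> Z D \<Longrightarrow> (norm (z $ r))\<^sup>2 / 2 = ell D r (mu z)"
  using mu_eqI unfolding Z_iff by metis

lemma mu_in_interior_iff: "z \<in> Z D \<Longrightarrow> mu z \<in> interior P \<longleftrightarrow> (\<forall>r. z $ r \<noteq> 0)"
  by (simp add: interior_P_eq norm_Z[symmetric])

lemma phi_P_proj:
  assumes "z \<in> Z D"
  shows "phi_P D (proj D z) = mu z"
  unfolding phi_P_def
proof (rule the_equality)
  show "\<exists>w\<in>Z D. proj D w = proj D z \<and> adjoint (beta D) (mu z) = phi_T D w"
    using norm_Z[OF assms] phi_T_eq_ell_iff[of D z "mu z"] assms by metis
next
  fix x assume "\<exists>w\<in>Z D. proj D w = proj D z \<and> adjoint (beta D) x = phi_T D w"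
  then obtain w where w: "proj D w = proj D z" "adjoint (beta D) x = phi_T D w" by blast
  then have "mu w = mu z" unfolding proj_eq_iff by auto
  moreover have "mu w = x" using w(2) phi_T_eq_ell_iff[of D w x] by (metis mu_eqI)
  ultimately show "x = mu z" by simp
qed

lemma proj_in_M_open_iff: "z \<in> Z D \<Longrightarrow> proj D z \<in> M_open D P \<longleftrightarrow> (\<forall>r. z $ r \<noteq> 0)"
  by (auto simp: M_open_def phi_P_proj mu_in_interior_iff M_def)

section \<open>Construction of the chart\<close>

definition root_point :: "real^'n \<Rightarrow> complex^'d" where
  "root_point x = (\<chi> r. of_real (sqrt (2 * ell D r x)))"

lemma norm_root_point: "x \<in> P \<Longrightarrow> (norm (root_point x $ r))\<^sup>2 / 2 = ell D r x"
  by (auto simp: root_point_def P_eq)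

lemma root_point_in_Z: "x \<in> P \<Longrightarrow> root_point x \<in> Z D"
  using norm_root_point Z_iff by blast

lemma mu_root_point: "x \<in> P \<Longrightarrow> mu (root_point x) = x"
  using norm_root_point by (rule mu_eqI)

lemma root_point_ne_0: "x \<in> interior P \<Longrightarrow> root_point x $ r \<noteq> 0"
  using ell_pos[of x r] by (simp add: root_point_def)

lemma interior_P_imp: "x \<in> interior P \<Longrightarrow> x \<in> P"
  using interior_subset by blast

text \<open>Polar form: on the level set the moduli are fixed by \<open>mu z\<close>, so the
  arguments recover \<open>z\<close>.\<close>

lemma torus_act_root_point:
  assumes "z \<in> Z D" "\<And>r. cis (a $ r) = sgn (z $ r)"
  shows "torus_act (torus_class a) (root_point (mu z)) = z"
proof -
  have "cis (a $ r) * of_real (sqrt (2 * ell D r (mu z))) = z $ r" for r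
    by (simp add: norm_Z[OF assms(1), symmetric] assms(2) sgn_eq)
  then show ?thesis by (simp add: vec_eq_iff torus_act_nth root_point_def)
qed

text \<open>Two choices of \<open>t\<close> over \<open>\<theta>\<close> differ by an element of
  \<open>K\<close>, so the value is well defined. A continuous choice of \<open>t\<close> on the
  whole torus need not exist; regularity is therefore proved through
  \<open>lift_chart\<close>.\<close>

definition chart :: "(real^'n) \<times> 'n torus \<Rightarrow> (complex^'d) set" where
  "chart = (\<lambda>(x, \<theta>). proj D (torus_act (SOME t. torus_hom D t = \<theta>) (root_point x)))"

lemma chart_eq:
  assumes "torus_hom D t = \<theta>"
  shows "chart (x, \<theta>) = proj D (torus_act t (root_point x))"
proof -
  let ?s = "SOME t. torus_hom D t = \<theta>"
  have "torus_hom D ?s = \<theta>" using assms by (rule someI)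
  then have "t - ?s \<in> K D" using assms by (simp add: K_def torus_hom_diff)
  moreover have "torus_act t (root_point x) = torus_act (t - ?s) (torus_act ?s (root_point x))"
    by (simp add: torus_act_plus[symmetric])
  ultimately have "proj D (torus_act ?s (root_point x)) = proj D (torus_act t (root_point x))"
    unfolding proj_eq_iff by blast
  then show ?thesis by (simp add: chart_def)
qed

text \<open>Invariance of \<open>mu\<close> recovers the action variable. Freeness then shows that
  the torus elements differ by one in \<open>K\<close>, so their images in the n-torus
  agree.\<close>

lemma chart_inj:
  assumes "x \<in> interior P" "y \<in> interior P" "chart (x, \<theta>) = chart (y, \<eta>)"
  shows "x = y \<and> \<theta> = \<eta>"
proof -
  obtain s t where st: "torus_hom D s = \<theta>" "torus_hom D t = \<eta>" using surj_torus_hom by metis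
  then obtain k where k: "k \<in> K D" "torus_act t (root_point y) = torus_act k (torus_act s (root_point x))"
    using assms(3) by (auto simp: chart_eq proj_eq_iff)
  then have "mu (root_point y) = mu (root_point x)" by (metis mu_torus_act)
  then have xy: "x = y" using assms by (simp add: mu_root_point interior_P_imp)
  then have "t = k + s"
    using k(2) by (intro torus_act_inj[OF root_point_ne_0[OF assms(1)]]) (simp add: torus_act_plus)
  then show ?thesis using st k(1) xy by (simp add: torus_hom_add K_def)
qed

lemma chart_in_M_open: "x \<in> interior P \<Longrightarrow> chart (x, \<theta>) \<in> M_open D P"
  by (rule surj_torus_hom[of \<theta>])
     (simp add: chart_eq proj_in_M_open_iff root_point_in_Z interior_P_imp root_point_ne_0)

text \<open>The chart on the universal cover: once \<open>\<theta>\<close> is replaced by a real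
  vector, the linear section yields an explicit smooth lift to \<open>Z D\<close>.\<close>

definition lift_chart :: "(real^'n) \<times> (real^'n) \<Rightarrow> complex^'d" where
  "lift_chart = (\<lambda>(x, s). torus_act (torus_class (section_beta s)) (root_point x))"

lemma chart_torus_class: "chart (x, torus_class s) = proj D (lift_chart (x, s))"
  unfolding lift_chart_def by (simp add: chart_eq[where t = "torus_class (section_beta s)"] torus_hom.abs_eq section_beta(2))

lemma lift_chart_in_Z: "x \<in> interior P \<Longrightarrow> lift_chart (x, s) \<in> Z D"
  by (simp add: lift_chart_def root_point_in_Z interior_P_imp)

lemma smooth_on_lift_chart: "smooth_on (interior P \<times> UNIV) lift_chart"
proof -
  have op: "open (interior P \<times> (UNIV :: (real^'n) set))" by (simp add: open_Times)
  have eq: "lift_chart = (\<lambda>p. \<chi> r. sqrt (2 * ell D r (fst p)) *\<^sub>R cis (section_beta (snd p) $ r))"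
    by (simp add: lift_chart_def fun_eq_iff vec_eq_iff torus_act_nth root_point_def scaleR_conv_of_real)
  have sec: "bounded_linear (\<lambda>p::(real^'n) \<times> (real^'n). section_beta (snd p) $ r)" for r
    using section_beta(1)
    by (intro bounded_linear_compose[OF bounded_linear_vec_nth] bounded_linear_compose[OF _ bounded_linear_snd])
       (simp add: linear_conv_bounded_linear)
  have ell: "smooth_on (interior P \<times> UNIV) (\<lambda>p::(real^'n) \<times> (real^'n). 2 * ell D r (fst p))" for r
    by (intro smooth_on_mult op smooth_on_const
        smooth_on_compose[OF op open_UNIV _ smooth_on_bounded_linear[OF bounded_linear_fst op] smooth_on_ell])
      auto
  show ?thesis
    unfolding eq
  proof (intro smooth_on_vec_lambda smooth_on_scaleR op)
    show "smooth_on (interior P \<times> UNIV) (\<lambda>p::(real^'n) \<times> (real^'n). sqrt (2 * ell D r (fst p)))" for r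
      by (rule smooth_on_compose[OF op _ _ ell smooth_on_sqrt]) (auto simp: ell_pos)
    show "smooth_on (interior P \<times> UNIV) (\<lambda>p::(real^'n) \<times> (real^'n). cis (section_beta (snd p) $ r))" for r
      by (rule smooth_on_compose[OF op open_UNIV _ smooth_on_bounded_linear[OF sec op] smooth_on_cis]) auto
  qed
qed

text \<open>Local inverses of \<open>lift_chart\<close>, defined near \<open>z\<close> by means of the branch of the argument that is
  continuous at \<open>z\<close>.\<close>

definition angle_nhd :: "complex^'d \<Rightarrow> (complex^'d) set" where
  "angle_nhd z = {y. \<forall>r. y $ r / z $ r \<notin> \<real>\<^sub>\<le>\<^sub>0}"

definition angle :: "complex^'d \<Rightarrow> complex^'d \<Rightarrow> real^'d" where
  "angle z y = (\<chi> r. Arg (z $ r) + Im (Ln (y $ r / z $ r)))"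

definition action_angle :: "complex^'d \<Rightarrow> complex^'d \<Rightarrow> (real^'n) \<times> (real^'n)" where
  "action_angle z y = (mu y, beta D (angle z y))"

lemma angle_nhd_self: "(\<And>r. z $ r \<noteq> 0) \<Longrightarrow> z \<in> angle_nhd z"
  by (simp add: angle_nhd_def)

lemma angle_nhd_ne_0: "y \<in> angle_nhd z \<Longrightarrow> y $ r \<noteq> 0" "y \<in> angle_nhd z \<Longrightarrow> z $ r \<noteq> 0"
  unfolding angle_nhd_def by (metis (mono_tags) mem_Collect_eq div_0 division_ring_divide_zero nonpos_Reals_zero_I)+

lemma open_angle_nhd: "open (angle_nhd z)"
proof -
  have "angle_nhd z = (\<Inter>r. (\<lambda>y. y $ r / z $ r) -` (- \<real>\<^sub>\<le>\<^sub>0))"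
    by (auto simp: angle_nhd_def)
  moreover have "open ((\<lambda>y. y $ r / z $ r) -` (- \<real>\<^sub>\<le>\<^sub>0))" for r
    unfolding divide_inverse by (intro open_vimage continuous_intros) (simp add: open_Compl)
  ultimately show ?thesis by (simp add: open_INT)
qed

text \<open>Smoothness is needed on an open subset of the ambient space, because
  \<open>smooth_on_M\<close> asks for local extensions beyond \<open>Z D\<close>. They will be
  compositions with \<open>action_angle z\<close>.\<close>

lemma smooth_on_action_angle: "smooth_on (angle_nhd z) (action_angle z)"
proof -
  note op = open_angle_nhd[of z]
  have phi: "smooth_on (angle_nhd z) (phi_T D)"
  proof -
    have "phi_T D = (\<lambda>y. \<chi> r. (1/2) * (y $ r \<bullet> y $ r) + facet_offset D r)"
      by (simp add: phi_T_def fun_eq_iff power2_norm_eq_inner)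
    then show ?thesis
      by (simp only:) (intro smooth_on_vec_lambda smooth_on_add smooth_on_mult smooth_on_const
          smooth_on_inner smooth_on_vec_nth op)
  qed
  have ang: "smooth_on (angle_nhd z) (angle z)"
    unfolding angle_def[abs_def]
  proof (intro smooth_on_vec_lambda smooth_on_add smooth_on_const op
      smooth_on_bounded_linear_comp[OF bounded_linear_Im])
    fix r
    have div: "smooth_on (angle_nhd z) (\<lambda>y. y $ r / z $ r)"
      unfolding divide_inverse by (intro smooth_on_mult smooth_on_vec_nth smooth_on_const op)
    show "smooth_on (angle_nhd z) (\<lambda>y. Ln (y $ r / z $ r))"
      by (rule smooth_on_compose[OF op _ _ div smooth_on_Ln]) (auto simp: angle_nhd_def open_Compl)
  qed
  have "bounded_linear (adjoint section_beta)"
    using adjoint_linear[OF section_beta(1)] linear_conv_bounded_linear by blast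
  then show ?thesis
    unfolding action_angle_def[abs_def] mu_def
    by (intro smooth_on_Pair op smooth_on_bounded_linear_comp[OF _ op phi]
        smooth_on_bounded_linear_comp[OF bounded_linear_beta op ang])
qed

lemma chart_action_angle:
  assumes "y \<in> angle_nhd z" "y \<in> Z D" "action_angle z y = (x, s)"
  shows "x \<in> interior P" "chart (x, torus_class s) = proj D y"
proof -
  have xs: "x = mu y" "s = beta D (angle z y)" using assms(3) by (simp_all add: action_angle_def)
  show "x \<in> interior P" using assms(1,2) angle_nhd_ne_0 by (simp add: xs mu_in_interior_iff)
  \<comment> \<open>The branch near \<open>z\<close> still computes a true argument of
    \<open>y $ r\<close>: the argument of \<open>z $ r\<close> plus that of the quotient.\<close>
  have "cis (angle z y $ r) = sgn (y $ r)" for r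
  proof -
    have ne: "y $ r \<noteq> 0" "z $ r \<noteq> 0" using angle_nhd_ne_0[OF assms(1)] by auto
    have "cis (angle z y $ r) = cis (Arg (z $ r)) * cis (Im (Ln (y $ r / z $ r)))"
      by (simp add: angle_def cis_mult)
    also have "\<dots> = sgn (z $ r) * sgn (y $ r / z $ r)"
      using ne by (simp add: cis_Arg Arg_eq_Im_Ln[symmetric])
    also have "\<dots> = sgn (z $ r * (y $ r / z $ r))" by (rule sgn_mult[symmetric])
    also have "\<dots> = sgn (y $ r)" using ne by simp
    finally show ?thesis .
  qed
  then have "torus_act (torus_class (angle z y)) (root_point (mu y)) = y"
    by (rule torus_act_root_point[OF assms(2)])
  then show "chart (x, torus_class s) = proj D y"
    using chart_eq[of "torus_class (angle z y)" "torus_class s" x] by (simp add: xs torus_hom.abs_eq)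
qed

lemma M_open_imp_chart:
  assumes "p \<in> M_open D P"
  obtains x \<theta> where "x \<in> interior P" "p = chart (x, \<theta>)"
proof -
  obtain z where z: "z \<in> Z D" "p = proj D z" using assms unfolding M_open_def M_def by blast
  then have "z \<in> angle_nhd z" using assms by (intro angle_nhd_self) (simp add: proj_in_M_open_iff)
  then show thesis
    using that chart_action_angle[of z z] z by (metis surj_pair)
qed

section \<open>The chart is a diffeomorphism\<close>

lemma openin_M_open: "openin (M_top D) (M_open D P)"
proof -
  have "{z \<in> Z D. proj D z \<in> M_open D P} = Z D \<inter> (\<Inter>r. {z. z $ r \<noteq> 0})"
    by (auto simp: proj_in_M_open_iff)
  moreover have "open (\<Inter>r. {z::complex^'d. z $ r \<noteq> 0})"
    by (intro open_INT ballI open_Collect_neq continuous_intros) auto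
  ultimately show ?thesis
    unfolding openin_M_top by (auto simp: M_open_def openin_open_Int)
qed

lemma openin_M_open_iff:
  "openin (subtopology (M_top D) (M_open D P)) V \<longleftrightarrow>
     V \<subseteq> M_open D P \<and> openin (top_of_set (Z D)) {z \<in> Z D. proj D z \<in> V}"
  unfolding openin_open_subtopology[OF openin_M_open] openin_M_top by (auto simp: M_open_def)

lemma topspace_M_open: "topspace (subtopology (M_top D) (M_open D P)) = M_open D P"
  using openin_subset[OF openin_M_open] by auto

lemma open_chart_vimage:
  assumes "openin (subtopology (M_top D) (M_open D P)) V"
  shows "open {(x, s). x \<in> interior P \<and> chart (x, torus_class s) \<in> V}"
proof -
  obtain S where S: "open S" "{z \<in> Z D. proj D z \<in> V} = Z D \<inter> S"
    using assms unfolding openin_M_open_iff openin_open by blast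
  have "{(x, s). x \<in> interior P \<and> chart (x, torus_class s) \<in> V} = (interior P \<times> UNIV) \<inter> lift_chart -` S"
    using S(2) lift_chart_in_Z by (auto simp: chart_torus_class)
  then show ?thesis
    using continuous_open_preimage[OF smooth_on_imp_continuous_on[OF smooth_on_lift_chart] _ S(1)]
    by (simp add: open_Times)
qed

text \<open>Continuity comes from the lift on the universal cover. Openness comes from the local
  inverses, so no global inverse on the quotient has to be written down.\<close>

lemma homeomorphic_map_chart:
  "homeomorphic_map (top_of_set (interior P \<times> UNIV)) (subtopology (M_top D) (M_open D P)) chart"
proof (rule bijective_open_imp_homeomorphic_map)
  have op: "open (interior P \<times> (UNIV :: 'n torus set))" by (simp add: open_Times)
  show "continuous_map (top_of_set (interior P \<times> UNIV)) (subtopology (M_top D) (M_open D P)) chart"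
    unfolding continuous_map_def topspace_M_open
  proof (intro conjI allI impI)
    show "chart \<in> topspace (top_of_set (interior P \<times> UNIV)) \<rightarrow> M_open D P"
      by (auto simp: chart_in_M_open)
    fix V assume "openin (subtopology (M_top D) (M_open D P)) V"
    from open_chart_vimage[OF this]
    have "open {y \<in> interior P \<times> UNIV. chart y \<in> V}"
      by (subst open_prod_torus_iff) (simp add: case_prod_unfold)
    then show "openin (top_of_set (interior P \<times> UNIV))
        {y \<in> topspace (top_of_set (interior P \<times> UNIV)). chart y \<in> V}"
      by (simp add: openin_open_eq[OF op] subset_iff)
  qed
  show "open_map (top_of_set (interior P \<times> UNIV)) (subtopology (M_top D) (M_open D P)) chart"
    unfolding open_map_def openin_open_eq[OF op]
  proof (intro allI impI)
    fix W :: "((real^'n) \<times> 'n torus) set"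
    assume W: "open W \<and> W \<subseteq> interior P \<times> UNIV"
    then have W': "open {(x, s). (x, torus_class s) \<in> W}" by (simp add: open_prod_torus_iff)
    have sub: "chart ` W \<subseteq> M_open D P" using W chart_in_M_open by force
    have "\<exists>T. openin (top_of_set (Z D)) T \<and> z \<in> T \<and> T \<subseteq> {z \<in> Z D. proj D z \<in> chart ` W}"
      if z: "z \<in> Z D" "proj D z \<in> chart ` W" for z
    proof (intro exI conjI)
      \<comment> \<open>The points near \<open>z\<close> whose local coordinates lie in
        \<open>W\<close>; on the level set they project into the image of \<open>W\<close>.\<close>
      let ?O = "angle_nhd z \<inter> action_angle z -` {(x, s). (x, torus_class s) \<in> W}"
      show "openin (top_of_set (Z D)) (Z D \<inter> ?O)"
        by (intro openin_open_Int continuous_open_preimage[OF smooth_on_imp_continuous_on[OF smooth_on_action_angle]]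
            open_angle_nhd W')
      show "Z D \<inter> ?O \<subseteq> {z \<in> Z D. proj D z \<in> chart ` W}"
      proof
        fix y assume y: "y \<in> Z D \<inter> ?O"
        obtain x s where xs: "action_angle z y = (x, s)" by (metis surj_pair)
        then show "y \<in> {z \<in> Z D. proj D z \<in> chart ` W}"
          using chart_action_angle(2)[of y z x s] y by (force simp: image_iff)
      qed
      have self: "z \<in> angle_nhd z"
        using z sub by (intro angle_nhd_self) (metis proj_in_M_open_iff subsetD)
      obtain x s where xs: "action_angle z z = (x, s)" by (metis surj_pair)
      note ch = chart_action_angle[OF self z(1) xs]
      \<comment> \<open>The coordinates computed at \<open>z\<close> must lie in \<open>W\<close>,
        but the assumption only gives some preimage of \<open>proj D z\<close> there; injectivity
        identifies the two.\<close>
      obtain y \<eta> where "(y, \<eta>) \<in> W" "proj D z = chart (y, \<eta>)" using z(2) by (metis imageE surj_pair)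
      then have "(x, torus_class s) \<in> W"
        using chart_inj[of x y "torus_class s" \<eta>] ch W by auto
      then show "z \<in> Z D \<inter> ?O" using z self xs by simp
    qed
    then have "openin (top_of_set (Z D)) {z \<in> Z D. proj D z \<in> chart ` W}"
      by (subst openin_subopen) blast
    then show "openin (subtopology (M_top D) (M_open D P)) (chart ` W)"
      using sub by (simp add: openin_M_open_iff)
  qed
  show "chart ` topspace (top_of_set (interior P \<times> UNIV)) = topspace (subtopology (M_top D) (M_open D P))"
    unfolding topspace_M_open using chart_in_M_open by (auto elim!: M_open_imp_chart)
  show "inj_on chart (topspace (top_of_set (interior P \<times> UNIV)))"
    using chart_inj by (auto simp: inj_on_def)
qed

text \<open>A smooth function on the quotient is pulled back along \<open>lift_chart\<close> through
  its local extensions. Conversely, a smooth function of the coordinates is extended off the level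
  set by composing it with \<open>action_angle z\<close>.\<close>

lemma coord_diffeo_chart: "coord_diffeo D P chart"
  unfolding coord_diffeo_def
proof (intro conjI allI impI homeomorphic_map_chart)
  fix V and f :: "(complex^'d) set \<Rightarrow> real"
  assume V: "openin (subtopology (M_top D) (M_open D P)) V"
  define U where "U = {(x, s). x \<in> interior P \<and> chart (x, torus_class s) \<in> V}"
  define F where "F = (\<lambda>(x, s). f (chart (x, torus_class s)))"
  have U: "open U" unfolding U_def by (rule open_chart_vimage[OF V])
  have prod_iff: "smooth_on_prod {y \<in> interior P \<times> UNIV. chart y \<in> V} (f \<circ> chart) \<longleftrightarrow> smooth_on U F"
    by (simp add: smooth_on_prod_def U_def F_def case_prod_unfold)
  show "smooth_on_M D V f \<longleftrightarrow> smooth_on_prod {y \<in> interior P \<times> UNIV. chart y \<in> V} (f \<circ> chart)"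
    unfolding prod_iff
  proof
    assume f: "smooth_on_M D V f"
    show "smooth_on U F"
    proof (rule smooth_on_locally)
      fix p assume "p \<in> U"
      moreover obtain x s where p: "p = (x, s)" by fastforce
      ultimately have "lift_chart p \<in> Z D" "proj D (lift_chart p) \<in> V"
        by (auto simp: U_def lift_chart_in_Z chart_torus_class)
      then obtain W h where W: "open W" "lift_chart p \<in> W" "smooth_on W h"
        "\<And>y. y \<in> W \<inter> Z D \<Longrightarrow> proj D y \<in> V \<Longrightarrow> h y = f (proj D y)"
        using f unfolding smooth_on_M_def by meson
      have lift: "smooth_on U lift_chart"
        by (rule smooth_on_mono[OF smooth_on_lift_chart]) (auto simp: U_def)
      let ?N = "U \<inter> lift_chart -` W"
      have N: "open ?N"
        by (rule continuous_open_preimage[OF smooth_on_imp_continuous_on[OF lift] U W(1)])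
      have "smooth_on ?N (\<lambda>q. h (lift_chart q))"
        by (rule smooth_on_compose[OF N W(1) _ smooth_on_mono[OF lift] W(3)]) auto
      then have "smooth_on ?N F"
        by (rule smooth_on_cong[OF N]) (auto simp: F_def U_def chart_torus_class W(4) lift_chart_in_Z)
      then show "\<exists>N. open N \<and> p \<in> N \<and> smooth_on N F" using N \<open>p \<in> U\<close> W(2) by blast
    qed
  next
    assume F: "smooth_on U F"
    show "smooth_on_M D V f"
      unfolding smooth_on_M_def
    proof (intro ballI impI)
      fix z assume z: "z \<in> Z D" "proj D z \<in> V"
      let ?W = "angle_nhd z \<inter> action_angle z -` U"
      have W: "open ?W"
        by (rule continuous_open_preimage[OF smooth_on_imp_continuous_on[OF smooth_on_action_angle] open_angle_nhd U])
      have "z \<in> angle_nhd z"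
        using z V by (intro angle_nhd_self) (metis openin_M_open_iff proj_in_M_open_iff subsetD)
      moreover obtain x s where xs: "action_angle z z = (x, s)" by (metis surj_pair)
      ultimately have "z \<in> ?W" using chart_action_angle[of z z x s] z by (simp add: U_def)
      moreover have "smooth_on ?W (\<lambda>y. F (action_angle z y))"
        by (rule smooth_on_compose[OF W U _ smooth_on_mono[OF smooth_on_action_angle] F]) auto
      moreover have "F (action_angle z y) = f (proj D y)" if "y \<in> ?W \<inter> Z D" for y
      proof -
        obtain x s where "action_angle z y = (x, s)" by (metis surj_pair)
        then show ?thesis using that chart_action_angle(2)[of y z x s] by (simp add: F_def)
      qed
      ultimately show "\<exists>W h. open W \<and> z \<in> W \<and> smooth_on W h \<and>
          (\<forall>y\<in>W \<inter> Z D. proj D y \<in> V \<longrightarrow> h y = f (proj D y))"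
        using W by (intro exI[of _ ?W] exI[of _ "\<lambda>y. F (action_angle z y)"]) simp
    qed
  qed
qed

section \<open>Moment map and torus action in the chart\<close>

lemma phi_P_chart: "x \<in> interior P \<Longrightarrow> phi_P D (chart (x, \<theta>)) = x"
  by (rule surj_torus_hom[of \<theta>])
     (simp add: chart_eq phi_P_proj root_point_in_Z interior_P_imp mu_root_point)

text \<open>Whatever lift and whatever torus element over \<open>s\<close> are chosen, the result is
  \<open>root_point x\<close> moved by an element over \<open>s + \<theta>\<close>, so
  \<open>chart_eq\<close> applies.\<close>

lemma tau_chart:
  assumes "x \<in> interior P"
  shows "tau D s (chart (x, \<theta>)) = chart (x, s + \<theta>)"
  unfolding tau_def
proof (rule the_equality)
  obtain u t where ut: "torus_hom D u = s" "torus_hom D t = \<theta>" using surj_torus_hom by metis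
  show "\<exists>t. \<exists>z\<in>Z D. torus_hom D t = s \<and> proj D z = chart (x, \<theta>) \<and> chart (x, s + \<theta>) = proj D (torus_act t z)"
    using ut assms
    by (intro exI[of _ u] bexI[of _ "torus_act t (root_point x)"])
       (simp_all add: chart_eq[where t = "u + t"] chart_eq[where t = t] torus_hom_add torus_act_plus
         root_point_in_Z interior_P_imp)
  fix q
  assume "\<exists>t. \<exists>z\<in>Z D. torus_hom D t = s \<and> proj D z = chart (x, \<theta>) \<and> q = proj D (torus_act t z)"
  then obtain v z where v: "torus_hom D v = s" "proj D z = chart (x, \<theta>)" "q = proj D (torus_act v z)"
    by blast
  then have "proj D (torus_act t (root_point x)) = proj D z" using chart_eq[OF ut(2)] by simp
  then obtain k where k: "k \<in> K D" "z = torus_act k (torus_act t (root_point x))"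
    unfolding proj_eq_iff by blast
  then have "torus_hom D (v + (k + t)) = s + \<theta>"
    using v(1) ut(2) by (simp add: torus_hom_add K_def)
  then show "q = chart (x, s + \<theta>)"
    by (simp add: v(3) k(2) chart_eq torus_act_plus)
qed

section \<open>The potential\<close>

lemma smooth_on_g_P: "smooth_on (interior P) (g_P D)"
proof -
  note op = open_interior[of P]
  show ?thesis
    unfolding g_P_def[abs_def]
    by (intro smooth_on_mult smooth_on_sum smooth_on_const smooth_on_ell op finite_UNIV
        smooth_on_compose[OF op _ _ _ smooth_on_ln]) (auto simp: ell_pos)
qed

lemma partial_g_P:
  assumes x: "x \<in> interior P"
  shows "partial j (g_P D) x = (1/2) * (\<Sum>r\<in>UNIV. conormal D r $ j * (ln (ell D r x) + 1))"
proof -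
  have "(g_P D has_derivative (\<lambda>v. (1/2) * (\<Sum>r\<in>UNIV. (v \<bullet> conormal D r) * (ln (ell D r x) + 1)))) (at x)"
    unfolding g_P_def[abs_def]
    by (rule derivative_eq_intros ext ell_pos[OF x] refl)+
       (use ell_pos[OF x] in \<open>auto intro!: sum.cong simp: field_simps less_imp_neq[symmetric]\<close>)
  then show ?thesis
    by (simp add: partial_def frechet_derivative_at[symmetric] inner_axis')
qed

lemma Hess_g_P:
  assumes x: "x \<in> interior P"
  shows "Hess (g_P D) x $ i $ j = (\<Sum>r\<in>UNIV. conormal D r $ i * conormal D r $ j / (2 * ell D r x))"
proof -
  have "((\<lambda>y. (1/2) * (\<Sum>r\<in>UNIV. conormal D r $ j * (ln (ell D r y) + 1))) has_derivative
      (\<lambda>v. \<Sum>r\<in>UNIV. (v \<bullet> conormal D r) * conormal D r $ j / (2 * ell D r x))) (at x)"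
    by (rule derivative_eq_intros ext ell_pos[OF x] refl)+
       (auto intro!: sum.cong simp: sum_distrib_left field_simps)
  then have "(partial j (g_P D) has_derivative
      (\<lambda>v. \<Sum>r\<in>UNIV. (v \<bullet> conormal D r) * conormal D r $ j / (2 * ell D r x))) (at x)"
    by (rule has_derivative_transform_within_open[OF _ open_interior x]) (simp add: partial_g_P)
  then show ?thesis
    by (simp add: Hess_def partial_def[of i] frechet_derivative_at[symmetric] inner_axis')
qed

text \<open>The quadratic form of the Hessian is a sum of squares of the
  \<open>v \<bullet> conormal D r\<close> with positive weights, so a kernel vector is orthogonal to
  every conormal.\<close>

lemma invertible_Hess_g_P:
  assumes x: "x \<in> interior P"
  shows "invertible (Hess (g_P D) x)"
proof -
  have "v = 0" if v: "Hess (g_P D) x *v v = 0" for v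
  proof -
    have "v \<bullet> (Hess (g_P D) x *v v) =
        (\<Sum>i\<in>UNIV. \<Sum>j\<in>UNIV. \<Sum>r\<in>UNIV. v $ i * (conormal D r $ i * conormal D r $ j / (2 * ell D r x)) * v $ j)"
      by (simp add: inner_vec_def matrix_vector_mult_def Hess_g_P[OF x] sum_distrib_left sum_distrib_right mult.assoc)
    also have "\<dots> = (\<Sum>i\<in>UNIV. \<Sum>r\<in>UNIV. \<Sum>j\<in>UNIV. v $ i * (conormal D r $ i * conormal D r $ j / (2 * ell D r x)) * v $ j)"
      by (rule sum.cong[OF refl sum.swap])
    also have "\<dots> = (\<Sum>r\<in>UNIV. \<Sum>i\<in>UNIV. \<Sum>j\<in>UNIV. v $ i * (conormal D r $ i * conormal D r $ j / (2 * ell D r x)) * v $ j)"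
      by (rule sum.swap)
    also have "\<dots> = (\<Sum>r\<in>UNIV. (v \<bullet> conormal D r)\<^sup>2 / (2 * ell D r x))"
      by (simp add: inner_vec_def power2_eq_square sum_product sum_divide_distrib mult_ac)
    finally have "(\<Sum>r\<in>UNIV. (v \<bullet> conormal D r)\<^sup>2 / (2 * ell D r x)) = 0" by (simp add: v)
    then have "(v \<bullet> conormal D r)\<^sup>2 / (2 * ell D r x) = 0" for r
      using ell_pos[OF x] by (subst (asm) sum_nonneg_eq_0_iff) (auto intro!: divide_nonneg_pos)
    then have "v \<bullet> conormal D r = 0" for r using ell_pos[OF x, of r] by (metis divide_eq_0_iff less_irrefl mult_eq_0_iff power2_eq_iff_nonneg power_eq_0_iff zero_neq_numeral)
    then show "v = 0" by (rule conormal_separates)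
  qed
  then show ?thesis
    using matrix_left_invertible_ker invertible_left_inverse by blast
qed

section \<open>The coordinate frame\<close>

definition lift_x :: "real^'n \<Rightarrow> 'n \<Rightarrow> complex^'d" where
  "lift_x x j = (\<chi> r. of_real (conormal D r $ j / sqrt (2 * ell D r x)))"

text \<open>The vector \<zeta>_j: its components are the logarithmic derivatives of the coordinates
  of \<open>root_point x\<close> along x_j.\<close>

definition dlog :: "real^'n \<Rightarrow> 'n \<Rightarrow> real^'d" where
  "dlog x j = (\<chi> r. conormal D r $ j / (2 * ell D r x))"

text \<open>The combination of the \<open>dlog x i\<close> that \<open>beta D\<close> maps to
  \<open>axis j 1\<close>. Staying in their span keeps its generator horizontal.\<close>

definition dual_dlog :: "real^'n \<Rightarrow> 'n \<Rightarrow> real^'d" where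
  "dual_dlog x j = (\<Sum>i\<in>UNIV. matrix_inv (Hess (g_P D) x) $ i $ j *\<^sub>R dlog x i)"

lemma beta_dlog: "x \<in> interior P \<Longrightarrow> beta D (dlog x j) = (\<chi> k. Hess (g_P D) x $ k $ j)"
  by (simp add: vec_eq_iff beta_def dlog_def Hess_g_P mult_ac)

lemma matrix_inv_Hess_g_P:
  assumes "x \<in> interior P"
  shows "Hess (g_P D) x ** matrix_inv (Hess (g_P D) x) = mat 1"
    "matrix_inv (Hess (g_P D) x) ** Hess (g_P D) x = mat 1"
  using someI_ex[OF invertible_Hess_g_P[OF assms, unfolded invertible_def]]
  by (simp_all add: matrix_inv_def)

lemma beta_dual_dlog:
  assumes "x \<in> interior P"
  shows "beta D (dual_dlog x j) = axis j 1"
proof -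
  have "beta D (dual_dlog x j) $ k = (Hess (g_P D) x ** matrix_inv (Hess (g_P D) x)) $ k $ j" for k
    by (simp add: dual_dlog_def linear_sum[OF linear_beta] linear_scale[OF linear_beta] beta_dlog assms
        matrix_matrix_mult_def mult_ac)
  then show ?thesis by (simp add: matrix_inv_Hess_g_P assms vec_eq_iff mat_def axis_def)
qed

text \<open>Inverts the definition of \<open>dual_dlog\<close>; on generators this expresses J on
  \<partial>/\<partial>x_j through the \<partial>/\<partial>\<theta>_i.\<close>

lemma sum_Hess_dual_dlog:
  assumes "x \<in> interior P"
  shows "(\<Sum>i\<in>UNIV. Hess (g_P D) x $ i $ j *\<^sub>R dual_dlog x i) = dlog x j"
proof -
  have "(\<Sum>i\<in>UNIV. Hess (g_P D) x $ i $ j *\<^sub>R dual_dlog x i) =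
      (\<Sum>i\<in>UNIV. \<Sum>k\<in>UNIV. (matrix_inv (Hess (g_P D) x) $ k $ i * Hess (g_P D) x $ i $ j) *\<^sub>R dlog x k)"
    by (simp add: dual_dlog_def scaleR_sum_right mult_ac)
  also have "\<dots> = (\<Sum>k\<in>UNIV. (matrix_inv (Hess (g_P D) x) ** Hess (g_P D) x) $ k $ j *\<^sub>R dlog x k)"
    by (subst sum.swap) (simp add: matrix_matrix_mult_def scaleR_sum_left)
  also have "\<dots> = dlog x j"
    by (simp add: matrix_inv_Hess_g_P assms mat_def if_distrib[of "\<lambda>c. c *\<^sub>R _"] cong: if_cong)
  finally show ?thesis .
qed

lemma std_J_lift_x:
  assumes "x \<in> interior P"
  shows "std_J (lift_x x j) = generator (dlog x j) (root_point x)"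
proof -
  have "of_real (conormal D r $ j / sqrt (2 * ell D r x)) =
      (of_real (conormal D r $ j / (2 * ell D r x) * sqrt (2 * ell D r x)) :: complex)" for r
    using ell_pos[OF assms, of r]
    by (intro arg_cong[where f = of_real]) (simp add: field_simps real_sqrt_mult)
  then show ?thesis
    by (simp add: std_J_def generator_eq lift_x_def dlog_def root_point_def vec_eq_iff)
qed

lemma lift_x_inner:
  assumes "x \<in> interior P"
  shows "root_point x $ r \<bullet> lift_x x j $ r = conormal D r $ j"
  using ell_pos[OF assms, of r] by (simp add: root_point_def lift_x_def inner_complex_def)

text \<open>Tangency is the equation \<open>beta D \<xi> = 0\<close> read off in component
  \<open>j\<close>. Orthogonality holds because the lift is real and generators at the real point
  \<open>root_point x\<close> are imaginary.\<close>

lemma lift_x_horizontal: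
  assumes "x \<in> interior P"
  shows "lift_x x j \<in> horizontal D (root_point x)"
  unfolding horizontal_iff
proof (intro conjI ballI)
  show "lift_x x j \<in> tangent_Z D (root_point x)"
    by (simp add: tangent_Z_iff lift_x_inner assms Lie_K_sum)
  show "lift_x x j \<bullet> generator \<xi> (root_point x) = 0" for \<xi>
    by (auto simp: inner_vec_complex lift_x_def generator_eq root_point_def intro!: sum.neutral)
qed

text \<open>The squared modulus \<open>2 * ell D r x\<close> of the r-th coordinate cancels the
  denominator of \<open>dlog\<close>, so the inner product is a component of
  \<open>beta D \<xi>\<close>.\<close>

lemma generator_dlog_horizontal:
  assumes "x \<in> interior P"
  shows "generator (dlog x j) (root_point x) \<in> horizontal D (root_point x)"
  unfolding horizontal_iff
proof (intro conjI ballI generator_tangent_Z)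
  fix \<xi> assume \<xi>: "\<xi> \<in> Lie_K D"
  have "generator (dlog x j) (root_point x) $ r \<bullet> generator \<xi> (root_point x) $ r = \<xi> $ r * conormal D r $ j" for r
    using ell_pos[OF assms, of r]
    by (simp add: generator_eq dlog_def root_point_def inner_complex_def field_simps real_sqrt_mult)
  then show "generator (dlog x j) (root_point x) \<bullet> generator \<xi> (root_point x) = 0"
    by (simp add: inner_vec_def Lie_K_sum[OF \<xi>])
qed

lemma generator_dual_dlog: "generator (dual_dlog x j) z =
    (\<Sum>i\<in>UNIV. matrix_inv (Hess (g_P D) x) $ i $ j *\<^sub>R generator (dlog x i) z)"
  by (simp add: dual_dlog_def generator_sum generator_scaleR)

lemma root_point_has_vector_derivative:
  assumes "x \<in> interior P"
  shows "((\<lambda>s. root_point (x + s *\<^sub>R axis j 1)) has_vector_derivative lift_x x j) (at 0)"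
  unfolding root_point_def lift_x_def
proof (rule has_vector_derivative_vec_lambda, rule bounded_linear.has_vector_derivative[OF bounded_linear_of_real])
  fix r
  have "((\<lambda>s. ell D r (x + s *\<^sub>R axis j 1)) has_real_derivative conormal D r $ j) (at 0)"
    unfolding ell_def inner_add_left inner_scaleR_left by (auto intro!: derivative_eq_intros simp: inner_axis')
  then have "((\<lambda>s. sqrt (2 * ell D r (x + s *\<^sub>R axis j 1))) has_real_derivative
      conormal D r $ j / sqrt (2 * ell D r x)) (at 0)"
    using ell_pos[OF assms, of r] by (auto intro!: derivative_eq_intros simp: field_simps)
  then show "((\<lambda>s. sqrt (2 * ell D r (x + s *\<^sub>R axis j 1))) has_vector_derivative
      conormal D r $ j / sqrt (2 * ell D r x)) (at 0)"
    by (simp add: has_real_derivative_iff_has_vector_derivative)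
qed

section \<open>Frame, symplectic form and complex structure on horizontal lifts\<close>

definition frame_lift :: "'d torus \<Rightarrow> real^'n \<Rightarrow> 'n + 'n \<Rightarrow> complex^'d" where
  "frame_lift t x i = torus_act t (case i of Inl j \<Rightarrow> lift_x x j
     | Inr j \<Rightarrow> generator (dual_dlog x j) (root_point x))"

lemma frame_lift_horizontal:
  "x \<in> interior P \<Longrightarrow> frame_lift t x i \<in> horizontal D (torus_act t (root_point x))"
  unfolding frame_lift_def
  by (intro torus_act_horizontal)
     (auto split: sum.split simp: lift_x_horizontal generator_dual_dlog
       intro!: horizontal_sum generator_dlog_horizontal)

text \<open>The coordinate curves lift to the path of root points and to the one-parameter group of
  \<open>dual_dlog\<close>, both translated by \<open>t\<close>. Another vector over
  \<open>axis j 1\<close> would lift the angular curve as well; this one gives a horizontal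
  velocity.\<close>

lemma frame_chart:
  assumes x: "x \<in> interior P" and t: "torus_hom D t = \<theta>"
  shows "frame D chart x \<theta> i = dproj D (torus_act t (root_point x)) (frame_lift t x i)"
proof (cases i)
  case (Inl j)
  let ?\<gamma> = "\<lambda>s. torus_act t (root_point (x + s *\<^sub>R axis j 1))"
  have "((\<lambda>s. x + s *\<^sub>R axis j 1) \<longlongrightarrow> x + 0 *\<^sub>R axis j 1) (nhds (0::real))"
    by (intro tendsto_intros filterlim_ident)
  then have "\<forall>\<^sub>F s in nhds 0. x + s *\<^sub>R axis j 1 \<in> interior P"
    using topological_tendstoD[OF _ open_interior] x by fastforce
  then have "\<forall>\<^sub>F s in nhds 0. ?\<gamma> s \<in> Z D \<and> proj D (?\<gamma> s) = chart (x + s *\<^sub>R axis j 1, \<theta>)"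
    by eventually_elim (simp add: root_point_in_Z interior_P_imp chart_eq[OF t])
  then have "velocity D (\<lambda>s. chart (x + s *\<^sub>R axis j 1, \<theta>)) = dproj D (?\<gamma> 0) (torus_act t (lift_x x j))"
    by (rule velocity_eq[OF _ bounded_linear.has_vector_derivative[OF bounded_linear_torus_act
            root_point_has_vector_derivative[OF x]]]) (simp add: root_point_ne_0[OF x])
  then show ?thesis by (simp add: frame_def frame_lift_def Inl)
next
  case (Inr j)
  let ?z = "torus_act t (root_point x)" and ?\<eta> = "dual_dlog x j"
  let ?\<gamma> = "\<lambda>s. torus_act (torus_class (s *\<^sub>R ?\<eta>)) ?z"
  have "proj D (?\<gamma> s) = chart (x, \<theta> + torus_class (s *\<^sub>R axis j 1))" for s
    using chart_eq[of "torus_class (s *\<^sub>R ?\<eta>) + t" "\<theta> + torus_class (s *\<^sub>R axis j 1)" x]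
    by (simp add: torus_hom_add t torus_hom.abs_eq linear_scale[OF linear_beta] beta_dual_dlog[OF x]
        add.commute[of \<theta>] torus_act_plus)
  then have "\<forall>\<^sub>F s in nhds 0. ?\<gamma> s \<in> Z D \<and> proj D (?\<gamma> s) = chart (x, \<theta> + torus_class (s *\<^sub>R axis j 1))"
    using x by (simp add: root_point_in_Z interior_P_imp)
  then have "velocity D (\<lambda>s. chart (x, \<theta> + torus_class (s *\<^sub>R axis j 1))) = dproj D (?\<gamma> 0) (generator ?\<eta> ?z)"
    by (rule velocity_eq[OF _ has_vector_derivative_torus_act]) (simp add: root_point_ne_0[OF x])
  then show ?thesis
    by (simp add: frame_def frame_lift_def Inr generator_torus_act zero_torus_def[symmetric])
qed

text \<open>Two real vectors or two imaginary ones pair to zero. In the mixed case the moment map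
  identity turns the pairing into minus a component of
  \<open>beta D (dual_dlog x b)\<close>.\<close>

lemma omega_P_frame_chart:
  assumes x: "x \<in> interior P"
  shows "omega_P D (frame D chart x \<theta> i) (frame D chart x \<theta> j) = darboux i j"
proof -
  obtain t where t: "torus_hom D t = \<theta>" by (rule surj_torus_hom)
  let ?a = "\<lambda>i. case i of Inl j \<Rightarrow> lift_x x j | Inr j \<Rightarrow> generator (dual_dlog x j) (root_point x)"
  have "omega_P D (frame D chart x \<theta> i) (frame D chart x \<theta> j) = std_form (frame_lift t x i) (frame_lift t x j)"
    unfolding frame_chart[OF x t] using frame_lift_horizontal[OF x]
    by (intro omega_P_dproj) (auto simp: root_point_in_Z interior_P_imp root_point_ne_0 x horizontal_iff)
  also have "\<dots> = std_form (?a i) (?a j)" by (simp add: frame_lift_def)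
  also have "\<dots> = darboux i j"
  proof -
    have xx: "std_form (lift_x x a) (lift_x x b) = 0" for a b
      by (simp add: std_form_def lift_x_def)
    have tt: "std_form (generator \<xi> (root_point x)) (generator \<eta> (root_point x)) = 0" for \<xi> \<eta>
      by (simp add: std_form_def generator_eq root_point_def)
    have tx: "std_form (generator (dual_dlog x b) (root_point x)) (lift_x x a) = - (if a = b then 1 else 0)" for a b
    proof -
      have "(\<Sum>r\<in>UNIV. dual_dlog x b $ r * conormal D r $ a) = beta D (dual_dlog x b) $ a"
        by (simp add: beta_def)
      then show ?thesis
        by (simp add: std_form_generator lift_x_inner[OF x] beta_dual_dlog[OF x] axis_def)
    qed
    show ?thesis
      using std_form_commute[of "lift_x x _" "generator (dual_dlog x _) (root_point x)"]
      by (auto simp: darboux_def xx tt tx split: sum.split)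
  qed
  finally show ?thesis .
qed

lemma symplectic_coordinates_chart: "symplectic_coordinates D P chart"
  unfolding symplectic_coordinates_def
  by (simp add: coord_diffeo_chart phi_P_chart tau_chart omega_P_frame_chart)

text \<open>All frame lifts sit over one point and are horizontal, so the identity can be checked in
  the ambient complex space, column by column.\<close>

lemma represents_J_chart:
  assumes x: "x \<in> interior P"
  shows "represents_J D chart x \<theta>
    (block_matrix 0 (- matrix_inv (Hess (g_P D) x)) (Hess (g_P D) x) 0)"
  unfolding represents_J_def
proof
  fix j :: "'n + 'n"
  obtain t where t: "torus_hom D t = \<theta>" by (rule surj_torus_hom)
  let ?z = "torus_act t (root_point x)"
  let ?A = "block_matrix 0 (- matrix_inv (Hess (g_P D) x)) (Hess (g_P D) x) 0"
  have z: "?z \<in> Z D" "\<And>r. ?z $ r \<noteq> 0"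
    using x by (simp_all add: root_point_in_Z interior_P_imp root_point_ne_0)
  have "std_J (frame_lift t x j) = (\<Sum>i\<in>UNIV. ?A $ i $ j *\<^sub>R frame_lift t x i)"
  proof (cases j)
    case (Inl b)
    have "(\<Sum>i\<in>UNIV. ?A $ i $ j *\<^sub>R frame_lift t x i) =
        torus_act t (generator (\<Sum>i\<in>UNIV. Hess (g_P D) x $ i $ b *\<^sub>R dual_dlog x i) (root_point x))"
      by (simp add: sum_UNIV_Plus Inl block_matrix_def frame_lift_def generator_sum generator_scaleR
          linear_sum[OF linear_torus_act] linear_scale[OF linear_torus_act])
    then show ?thesis
      by (simp add: sum_Hess_dual_dlog x Inl frame_lift_def std_J_torus_act std_J_lift_x)
  next
    case (Inr b)
    \<comment> \<open>The generators of the \<open>dlog x i\<close> are already \<open>std_J\<close>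
      of the real lifts, so a second \<open>std_J\<close> returns minus these lifts.\<close>
    have "std_J (generator (dual_dlog x b) (root_point x)) =
        (\<Sum>i\<in>UNIV. matrix_inv (Hess (g_P D) x) $ i $ b *\<^sub>R - lift_x x i)"
      by (simp add: generator_dual_dlog linear_sum[OF linear_std_J] linear_scale[OF linear_std_J]
          std_J_lift_x[OF x, symmetric] std_J_std_J)
    then show ?thesis
      by (simp add: sum_UNIV_Plus Inr block_matrix_def frame_lift_def std_J_torus_act
          linear_sum[OF linear_torus_act] linear_scale[OF linear_torus_act] linear_neg[OF linear_torus_act])
  qed
  then have "J_P D (frame D chart x \<theta> j) = dproj D ?z (\<Sum>i\<in>UNIV. ?A $ i $ j *\<^sub>R frame_lift t x i)"
    unfolding frame_chart[OF x t] using J_P_dproj[OF z frame_lift_horizontal[OF x]] by simp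
  also have "\<dots> = lin_comb D (\<lambda>i. ?A $ i $ j) (\<lambda>i. dproj D ?z (frame_lift t x i))"
    using frame_lift_horizontal[OF x] by (intro lin_comb_dproj[symmetric] z) (simp add: horizontal_iff)
  also have "(\<lambda>i. dproj D ?z (frame_lift t x i)) = frame D chart x \<theta>"
    by (rule ext) (rule frame_chart[OF x t, symmetric])
  finally show "J_P D (frame D chart x \<theta> j) = lin_comb D (\<lambda>i. ?A $ i $ j) (frame D chart x \<theta>)" .
qed

end

theorem theorem1:
  fixes P :: "(real^'n::finite) set" and D :: "('n, 'd::finite) facet_data"
  assumes "labeled_polytope P D"
  shows "smooth_on (interior P) (g_P D) \<and>
    (\<exists>\<Psi>. symplectic_coordinates D P \<Psi> \<and>
      (\<forall>x\<in>interior P. \<forall>\<theta>.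
         invertible (Hess (g_P D) x) \<and>
         represents_J D \<Psi> x \<theta>
           (block_matrix 0 (- matrix_inv (Hess (g_P D) x))
                         (Hess (g_P D) x) 0)))"
proof -
  interpret toric P D by unfold_locales (rule assms)
  show ?thesis
    using smooth_on_g_P symplectic_coordinates_chart invertible_Hess_g_P represents_J_chart by blast
qed

end
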